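(* Consider the online algorithm N-EQUI which, at every time $t$ with $n_t$ active jobs, allocates $P/n_t$ processors to each active job $J_i$ and sets the speed of the $j$-th processor allocated to $J_i$ to $\left(\frac{1}{(\alpha-1)H_P\, j}\right)^{1/\alpha}$ for $1\le j\le P/n_t$, where $H_P=1+\frac12+\dots+\frac1P$. Then N-EQUI is $O(\ln P)$-competitive with respect to total flow time plus energy for any set of parallel jobs (with arbitrary release times): there is a constant $C$ depending only on $\alpha$ such that for every $P\ge 2$ and every job set $\mathcal{J}$, $G_{\text{N-EQUI}}(\mathcal{J})\le C\ln P\cdot G^*(\mathcal{J})$.
   Context: Model: there are $P$ processors whose speeds can be set individually at every time; a processor running at speed $s\ge 0$ consumes power $s^\alpha$, where $\alpha>1$ is a fixed constant. A job set $\mathcal{J}=\{J_1,\dots,J_n\}$: each job $J_i$ has a release time $r_i\ge0$ and a sequence of phases $J_i^1,\dots,J_i^{k_i}$ executed in order; phase $J_i^k$ has work $w_i^k>0$ and parallelism $h_i^k\in[1,\infty]$. If at time $t$ job $J_i$ is in phase $k$ and is allocated $a_i(t)$ processors with speeds $s_1\ge\dots\ge s_{a_i(t)}$, its execution rate is $\sum_{j=1}^{\min\{a_i(t),h_i^k\}}s_j$. A valid schedule uses disjoint processor sets with $\sum_i a_i(t)\le P$, unallocated processors have speed $0$, no job runs before its release, phases run in order, and each job completes at finite time $c_i$. A job is active at $t$ if $r_i\le t\le c_i$; $n_t$ is the number of active jobs. $F(\mathcal{J})=\sum_i(c_i-r_i)$, $E(\mathcal{J})=\int_0^\infty u_t\,dt$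 with $u_t$ the total power at time $t$, and $G(\mathcal{J})=F(\mathcal{J})+E(\mathcal{J})$; $G_A$ denotes its value under algorithm $A$ and $G^*$ the minimum over all valid schedules (optimal offline). N-EQUI is non-clairvoyant: it uses no information about the jobs' parallelism or remaining work. As in the paper, $P/n_t$ is treated as an integer (rounded down otherwise).
   Formalization: The bound is stated for executions of N-EQUI in which every job completes; with P/n_t rounded down, N-EQUI gives each job 0 processors and stalls forever once more than P jobs are active, so such job sets (where the claim fails) are excluded. *)

theory Defs
  imports "HOL-Analysis.Analysis"
begin

record phase =
  work :: real
  par :: ereal

record job =
  release :: real
  phases :: "phase list"

definition job_set :: "job list \<Rightarrow> bool" where
  "job_set J \<longleftrightarrow> (\<forall>jb \<in> set J. 0 \<le> release jb \<and> phases jb \<noteq> [] \<and>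
      (\<forall>ph \<in> set (phases jb). 0 < work ph \<and> 1 \<le> par ph))"

text \<open>
  Processors are numbered 0, ..., P - 1 and jobs are identified by their position in the job
  list.  \<^term>\<open>assigned S p t\<close> is the job that processor p is allocated to at time t, if any, so
  the processor sets of different jobs are disjoint by construction.
\<close>

record schedule =
  assigned :: "nat \<Rightarrow> real \<Rightarrow> nat option"
  speed :: "nat \<Rightarrow> real \<Rightarrow> real"

definition alloc :: "nat \<Rightarrow> schedule \<Rightarrow> nat \<Rightarrow> real \<Rightarrow> nat" where
  "alloc P S i t = card {p. p < P \<and> assigned S p t = Some i}"

definition speeds :: "nat \<Rightarrow> schedule \<Rightarrow> nat \<Rightarrow> real \<Rightarrow> real list" where
  "speeds P S i t =
     rev (sort (map (\<lambda>p. speed S p t) (filter (\<lambda>p. assigned S p t = Some i) [0..<P])))"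

text \<open>
  The list of speeds is in decreasing order, and entry j - 1 is the speed of the j-th processor of
  the job.  The sum up to the minimum of the allocation and the parallelism h ranges over the
  integers j not exceeding either of them (h may be infinite or fractional).
\<close>

definition rate :: "nat \<Rightarrow> schedule \<Rightarrow> nat \<Rightarrow> ereal \<Rightarrow> real \<Rightarrow> real" where
  "rate P S i h t = (\<Sum>j | j \<in> {1..alloc P S i t} \<and> ereal (real j) \<le> h. speeds P S i t ! (j - 1))"

text \<open>
  If phase k (counted from 0) of job i starts at time b, then \<^term>\<open>finish_times P J S i k b\<close> is the
  set of all times by which the work of this phase is done.
\<close>

definition finish_times ::
  "nat \<Rightarrow> job list \<Rightarrow> schedule \<Rightarrow> nat \<Rightarrow> nat \<Rightarrow> real \<Rightarrow> real set" where
  "finish_times P J S i k b =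
     {t. b \<le> t \<and> ennreal (work (phases (J ! i) ! k)) \<le>
        (\<integral>\<^sup>+x\<in>{b..t}. ennreal (rate P S i (par (phases (J ! i) ! k)) x) \<partial>lborel)}"

text \<open>\<^term>\<open>phase_start P J S i k\<close> is also the completion time of phase k - 1 if k > 0.\<close>

primrec phase_start :: "nat \<Rightarrow> job list \<Rightarrow> schedule \<Rightarrow> nat \<Rightarrow> nat \<Rightarrow> real" where
  "phase_start P J S i 0 = release (J ! i)"
| "phase_start P J S i (Suc k) = Inf (finish_times P J S i k (phase_start P J S i k))"

definition completion :: "nat \<Rightarrow> job list \<Rightarrow> schedule \<Rightarrow> nat \<Rightarrow> real" where
  "completion P J S i = phase_start P J S i (length (phases (J ! i)))"

definition valid_schedule :: "nat \<Rightarrow> job list \<Rightarrow> schedule \<Rightarrow> bool" where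
  "valid_schedule P J S \<longleftrightarrow>
     (\<forall>p<P. assigned S p \<in> measurable borel (count_space UNIV) \<and>
            speed S p \<in> borel_measurable borel) \<and>
     (\<forall>p<P. \<forall>t. 0 \<le> speed S p t) \<and>
     (\<forall>p<P. \<forall>t. assigned S p t = None \<longrightarrow> speed S p t = 0) \<and>
     (\<forall>p<P. \<forall>t i. assigned S p t = Some i \<longrightarrow> i < length J \<and> release (J ! i) \<le> t) \<and>
     (\<forall>i<length J. \<forall>k<length (phases (J ! i)).
        finish_times P J S i k (phase_start P J S i k) \<noteq> {})"

definition active :: "nat \<Rightarrow> job list \<Rightarrow> schedule \<Rightarrow> nat \<Rightarrow> real \<Rightarrow> bool" where
  "active P J S i t \<longleftrightarrow> i < length J \<and> release (J ! i) \<le> t \<and> t \<le> completion P J S i"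

definition num_active :: "nat \<Rightarrow> job list \<Rightarrow> schedule \<Rightarrow> real \<Rightarrow> nat" where
  "num_active P J S t = card {i. active P J S i t}"

definition flow_time :: "nat \<Rightarrow> job list \<Rightarrow> schedule \<Rightarrow> real" where
  "flow_time P J S = (\<Sum>i<length J. completion P J S i - release (J ! i))"

definition total_power :: "real \<Rightarrow> nat \<Rightarrow> schedule \<Rightarrow> real \<Rightarrow> real" where
  "total_power \<alpha> P S t = (\<Sum>p<P. speed S p t powr \<alpha>)"

definition energy :: "real \<Rightarrow> nat \<Rightarrow> schedule \<Rightarrow> ennreal" where
  "energy \<alpha> P S = (\<integral>\<^sup>+t\<in>{0..}. ennreal (total_power \<alpha> P S t) \<partial>lborel)"

definition total_cost :: "real \<Rightarrow> nat \<Rightarrow> job list \<Rightarrow> schedule \<Rightarrow> ennreal" where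
  "total_cost \<alpha> P J S = ennreal (flow_time P J S) + energy \<alpha> P S"

definition opt_cost :: "real \<Rightarrow> nat \<Rightarrow> job list \<Rightarrow> ennreal" where
  "opt_cost \<alpha> P J = (INF S \<in> {S. valid_schedule P J S}. total_cost \<alpha> P J S)"

text \<open>
  The share of the processors is rounded down.  It is 0 once more than P jobs are active; from then
  on no job makes progress, so the resulting schedule never finishes and is not valid.  The
  prescribed speeds decrease with j, in agreement with the order of \<^const>\<open>speeds\<close>.
\<close>

definition n_equi :: "real \<Rightarrow> nat \<Rightarrow> job list \<Rightarrow> schedule \<Rightarrow> bool" where
  "n_equi \<alpha> P J S \<longleftrightarrow> (\<forall>t. \<forall>i<length J.
     (active P J S i t \<longrightarrow>
        alloc P S i t = P div num_active P J S t \<and>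
        (\<forall>j\<in>{1..P div num_active P J S t}.
           speeds P S i t ! (j - 1) = (1 / ((\<alpha> - 1) * harm P * real j)) powr (1 / \<alpha>))) \<and>
     (\<not> active P J S i t \<longrightarrow> alloc P S i t = 0))"

end

theory Submission
  imports Defs
begin

text \<open>
  The power used by N-EQUI is at most n / (\<alpha> - 1), so it suffices to bound its flow time, which is
  the integral of n.  Fix a comparison schedule T of finite energy and call a job of N-EQUI
  unsaturated while its parallelism is smaller than its share of the processors.

  Unsaturated jobs: if h is the rounded down parallelism of a phase, N-EQUI runs it at rate at
  least h^(1 - 1/\<alpha>) / K with K = ((\<alpha> - 1) H)^(1/\<alpha>), while T runs it at rate at most
  h^(1 - 1/\<alpha>) (1 + u), u being the power that T spends on the job.  Hence the total time that jobs
  spend unsaturated is at most K times the cost of T.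

  Saturated jobs that T has already completed: weight such a job by (rank / P)^(1 - 1/\<alpha>), where the
  rank counts the active jobs released no later.  A rank never increases while its job is active,
  so the weighted work N-EQUI does after the completion in T is at most the weighted work that T
  did before, and the latter is at most (n / P)^(1 - 1/\<alpha>) times the total speed of T; by Young's
  inequality this costs n / 2 plus O(H) times the power of T.  On the other hand, if most active
  jobs are of this kind, then N-EQUI does weighted work at rate at least of order n / K, because the
  ranks of m jobs add up to at least m^2 / 2.
\<close>

section \<open>Elementary inequalities\<close>

text \<open>A form of Young's inequality with a free threshold \<theta>: if s exceeds \<theta>,
  multiplying s by (s / \<theta>)^(\<alpha> - 1) \<ge> 1 can only enlarge it.\<close>

lemma young_le:
  fixes s \<theta> \<alpha> :: real
  assumes "\<alpha> > 1" "s \<ge> 0" "\<theta> > 0"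
  shows "s \<le> \<theta> + \<theta> powr (1 - \<alpha>) * s powr \<alpha>"
proof (cases "s \<le> \<theta>")
  case True
  then show ?thesis by (simp add: add_increasing2)
next
  case False
  then have "s * 1 \<le> s * (s / \<theta>) powr (\<alpha> - 1)"
    using assms by (intro mult_left_mono ge_one_powr_ge_zero) auto
  also have "\<dots> = s * (s powr (\<alpha> - 1) * \<theta> powr (1 - \<alpha>))"
    using assms False by (simp add: powr_divide) (simp add: powr_diff field_simps)
  also have "\<dots> = \<theta> powr (1 - \<alpha>) * s powr \<alpha>"
    using assms False by (simp add: powr_diff)
  finally show ?thesis using assms by simp
qed

text \<open>The threshold \<theta> = N^(-1/\<alpha>) in \<open>young_le\<close> balances the two
  terms: N \<theta> and \<theta>^(1 - \<alpha>) both equal N^(1 - 1/\<alpha>).\<close>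

lemma sum_le_powr_sum_powr:
  fixes x :: "'a \<Rightarrow> real" and \<alpha> N :: real
  assumes "\<alpha> > 1" "finite A" "\<And>a. a \<in> A \<Longrightarrow> x a \<ge> 0" "real (card A) \<le> N" "N > 0"
  shows "sum x A \<le> N powr (1 - 1 / \<alpha>) * (1 + (\<Sum>a\<in>A. x a powr \<alpha>))"
proof -
  let ?\<theta> = "N powr (- 1 / \<alpha>)"
  have "sum x A \<le> (\<Sum>a\<in>A. ?\<theta> + ?\<theta> powr (1 - \<alpha>) * x a powr \<alpha>)"
    using assms by (intro sum_mono young_le) auto
  also have "\<dots> = real (card A) * ?\<theta> + ?\<theta> powr (1 - \<alpha>) * (\<Sum>a\<in>A. x a powr \<alpha>)"
    by (simp add: sum.distrib sum_distrib_left)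
  also have "\<dots> \<le> N * ?\<theta> + ?\<theta> powr (1 - \<alpha>) * (\<Sum>a\<in>A. x a powr \<alpha>)"
    using assms by (intro add_right_mono mult_right_mono) auto
  also have "N * ?\<theta> = N powr (1 - 1 / \<alpha>)"
    using assms powr_add[of N 1 "- 1 / \<alpha>"] by simp
  also have "?\<theta> powr (1 - \<alpha>) = N powr (1 - 1 / \<alpha>)"
    using assms by (simp add: powr_powr diff_divide_distrib)
  finally show ?thesis by (simp add: algebra_simps)
qed

text \<open>Parallelism may be fractional, but \<open>rate\<close> compares it with integers only,
  so its floor N carries all that matters.\<close>

lemma ereal_floor_bound:
  fixes h :: ereal
  assumes "1 \<le> h" "h < \<infinity>"
  obtains N :: nat where "N \<ge> 1" "\<And>j. ereal (real j) \<le> h \<longleftrightarrow> j \<le> N"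
proof -
  obtain r where r: "h = ereal r" using assms by (cases h) auto
  then have "1 \<le> r" using assms by (simp add: one_ereal_def)
  show ?thesis
  proof
    show "nat \<lfloor>r\<rfloor> \<ge> 1" using \<open>1 \<le> r\<close> by linarith
    show "ereal (real j) \<le> h \<longleftrightarrow> j \<le> nat \<lfloor>r\<rfloor>" for j
      using \<open>1 \<le> r\<close> r by (simp add: le_nat_iff le_floor_iff)
  qed
qed

text \<open>Every ordered pair satisfies at least one of the two comparisons, and swapping the pair
  shows that both hold equally often.\<close>

lemma card_sq_le_sum_rank:
  fixes r :: "'a \<Rightarrow> real"
  assumes "finite B"
  shows "(real (card B))\<^sup>2 \<le> 2 * (\<Sum>i\<in>B. real (card {j\<in>B. r j \<le> r i}))"
proof -
  have card: "real (card {j\<in>B. Q j}) = (\<Sum>j\<in>B. of_bool (Q j))" for Q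
    using assms by (simp add: Int_def)
  have "(real (card B))\<^sup>2 = (\<Sum>i\<in>B. \<Sum>j\<in>B. 1)"
    by (simp add: power2_eq_square)
  also have "\<dots> \<le> (\<Sum>i\<in>B. \<Sum>j\<in>B. of_bool (r j \<le> r i) + of_bool (r i \<le> r j))"
    by (intro sum_mono) auto
  also have "\<dots> = (\<Sum>i\<in>B. \<Sum>j\<in>B. of_bool (r j \<le> r i)) + (\<Sum>i\<in>B. \<Sum>j\<in>B. of_bool (r i \<le> r j))"
    by (simp add: sum.distrib)
  also have "(\<Sum>i\<in>B. \<Sum>j\<in>B. of_bool (r i \<le> r j)) = (\<Sum>i\<in>B. \<Sum>j\<in>B. of_bool (r j \<le> r i) :: real)"
    by (rule sum.swap)
  finally show ?thesis by (simp add: card)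
qed

subsection \<open>Integrals over intervals\<close>

lemma set_nn_integral_Icc_eq_Ico:
  fixes f :: "real \<Rightarrow> ennreal"
  shows "(\<integral>\<^sup>+x\<in>{a..b}. f x \<partial>lborel) = (\<integral>\<^sup>+x\<in>{a..<b}. f x \<partial>lborel)"
  by (intro nn_integral_cong_AE eventually_mono[OF AE_lborel_singleton[of b]])
    (auto simp: indicator_def)

text \<open>Continuity from below of the measure with density f. It carries a bound that holds
  strictly before the end of a phase over to the whole phase.\<close>

lemma set_nn_integral_Ico_le:
  fixes f :: "real \<Rightarrow> ennreal"
  assumes [measurable]: "f \<in> borel_measurable borel"
    and le: "\<And>t. a \<le> t \<Longrightarrow> t < b \<Longrightarrow> (\<integral>\<^sup>+x\<in>{a..t}. f x \<partial>lborel) \<le> c"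
  shows "(\<integral>\<^sup>+x\<in>{a..<b}. f x \<partial>lborel) \<le> c"
proof -
  let ?D = "density lborel f"
  let ?I = "\<lambda>n. {a..b - 1 / real (Suc n)}"
  have frac: "1 / real (Suc (Suc n)) \<le> 1 / real (Suc n)" for n
    by (intro divide_left_mono) auto
  have "incseq ?I"
    by (intro incseq_SucI atLeastatMost_subset_iff[THEN iffD2] disjI2 conjI order_refl
        diff_left_mono frac)
  have "{a..<b} = (\<Union>n. ?I n)"
  proof (intro equalityI subsetI)
    fix x assume x: "x \<in> {a..<b}"
    then obtain n where "1 / real (Suc n) < b - x"
      using nat_approx_posE[of "b - x"] by auto
    with x show "x \<in> (\<Union>n. ?I n)" by (intro UN_I[of n]) auto
  next
    fix x assume "x \<in> (\<Union>n. ?I n)"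
    then obtain n where "a \<le> x" "x \<le> b - 1 / real (Suc n)" by auto
    moreover have "1 / real (Suc n) > 0" by simp
    ultimately show "x \<in> {a..<b}" unfolding atLeastLessThan_iff by linarith
  qed
  then have "emeasure ?D {a..<b} = (SUP n. emeasure ?D (?I n))"
    using SUP_emeasure_incseq[of ?I ?D, OF _ \<open>incseq ?I\<close>] by (simp add: image_subset_iff)
  also have "\<dots> \<le> c"
  proof (rule SUP_least)
    fix n
    show "emeasure ?D (?I n) \<le> c"
    proof (cases "a \<le> b - 1 / real (Suc n)")
      case True
      moreover have "b - 1 / real (Suc n) < b" by simp
      ultimately show ?thesis using le[of "b - 1 / real (Suc n)"]
        by (simp add: emeasure_density)
    qed simp
  qed
  finally show ?thesis by (simp add: emeasure_density)
qed

text \<open>The counterpart by continuity from above, which has to start from a set of finite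
  measure; \<open>fin\<close> supplies it.\<close>

lemma le_set_nn_integral_Icc:
  fixes f :: "real \<Rightarrow> ennreal"
  assumes [measurable]: "f \<in> borel_measurable borel"
    and fin: "(\<integral>\<^sup>+x\<in>{a..b + 1}. f x \<partial>lborel) < \<infinity>"
    and ge: "\<And>t. b < t \<Longrightarrow> c \<le> (\<integral>\<^sup>+x\<in>{a..t}. f x \<partial>lborel)"
  shows "c \<le> (\<integral>\<^sup>+x\<in>{a..b}. f x \<partial>lborel)"
proof -
  let ?D = "density lborel f"
  let ?I = "\<lambda>n. {a..b + 1 / real (Suc n)}"
  have frac: "1 / real (Suc (Suc n)) \<le> 1 / real (Suc n)" for n
    by (intro divide_left_mono) auto
  have "decseq ?I"
    by (intro decseq_SucI atLeastatMost_subset_iff[THEN iffD2] disjI2 conjI order_refl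
        add_left_mono frac)
  have fin': "emeasure ?D (?I n) \<noteq> \<infinity>" for n
  proof -
    have "emeasure ?D (?I n) \<le> emeasure ?D {a..b + 1}"
      by (intro emeasure_mono) (auto simp: field_simps intro: order_trans)
    then show ?thesis using fin by (auto simp: emeasure_density top_unique)
  qed
  have "{a..b} = (\<Inter>n. ?I n)"
  proof (intro equalityI subsetI)
    fix x assume "x \<in> (\<Inter>n. ?I n)"
    then have x: "a \<le> x" "\<And>n. x \<le> b + 1 / real (Suc n)" by auto
    have "x \<le> b"
    proof (rule ccontr)
      assume "\<not> x \<le> b"
      then obtain n where "1 / real (Suc n) < x - b"
        using nat_approx_posE[of "x - b"] by auto
      with x(2)[of n] show False by simp
    qed
    with x show "x \<in> {a..b}" by simp
  qed (auto intro: add_increasing2)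
  then have "emeasure ?D {a..b} = (INF n. emeasure ?D (?I n))"
    using INF_emeasure_decseq[of ?I ?D, OF _ \<open>decseq ?I\<close>] fin' by (simp add: image_subset_iff)
  also have "\<dots> \<ge> c"
  proof (rule INF_greatest)
    fix n
    have "b < b + 1 / real (Suc n)" by simp
    from ge[OF this] show "c \<le> emeasure ?D (?I n)" by (simp add: emeasure_density)
  qed
  finally show ?thesis by (simp add: emeasure_density)
qed

text \<open>The first conjunct strengthens the induction: the next interval can be adjoined only if
  it does not begin before \<open>b 0\<close>. It also serves later to order release, phase starts
  and completion.\<close>

lemma sum_indicator_Ico:
  fixes b :: "nat \<Rightarrow> real"
  assumes "\<And>k. k < N \<Longrightarrow> b k \<le> b (Suc k)"
  shows "b 0 \<le> b N \<and> indicator {b 0..<b N} x = (\<Sum>k<N. indicator {b k..<b (Suc k)} x :: ennreal)"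
  using assms
proof (induction N)
  case (Suc N)
  then have "b 0 \<le> b N" "b N \<le> b (Suc N)"
    and sum: "indicator {b 0..<b N} x = (\<Sum>k<N. indicator {b k..<b (Suc k)} x :: ennreal)" by auto
  then show ?case
    unfolding sum.lessThan_Suc sum[symmetric] by (auto simp: indicator_def)
qed simp

lemma set_nn_integral_Ico_partition:
  fixes b :: "nat \<Rightarrow> real" and f :: "real \<Rightarrow> ennreal"
  assumes [measurable]: "f \<in> borel_measurable borel" and b: "\<And>k. k < N \<Longrightarrow> b k \<le> b (Suc k)"
  shows "(\<integral>\<^sup>+x\<in>{b 0..<b N}. f x \<partial>lborel) = (\<Sum>k<N. \<integral>\<^sup>+x\<in>{b k..<b (Suc k)}. f x \<partial>lborel)"
proof -
  have "indicator {b 0..<b N} x = (\<Sum>k<N. indicator {b k..<b (Suc k)} x :: ennreal)" for x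
    using sum_indicator_Ico[of N b x] b by blast
  then show ?thesis
    by (subst nn_integral_sum[symmetric]) (auto simp: sum_distrib_left)
qed

lemma Ico_partition:
  fixes b :: "nat \<Rightarrow> real"
  assumes "b 0 \<le> x" "x < b N"
  obtains k where "k < N" "b k \<le> x" "x < b (Suc k)"
  using assms
proof (induction N arbitrary: thesis)
  case (Suc N)
  show ?case
  proof (cases "x < b N")
    case True
    then show ?thesis using Suc.IH Suc.prems less_Suc_eq by metis
  next
    case False
    then show ?thesis using Suc.prems by force
  qed
qed simp

subsection \<open>Valid schedules\<close>

text \<open>Indexing by processors instead of positions in the sorted list \<open>speeds\<close>
  makes measurability and summation over jobs straightforward. With the identity for
  \<open>f\<close> this is the total speed spent on job i, with \<open>x powr \<alpha>\<close> the
  power.\<close>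

definition job_sum :: "(real \<Rightarrow> real) \<Rightarrow> nat \<Rightarrow> schedule \<Rightarrow> nat \<Rightarrow> real \<Rightarrow> real" where
  "job_sum f P S i t = (\<Sum>p<P. if assigned S p t = Some i then f (speed S p t) else 0)"

lemma length_speeds: "length (speeds P S i t) = alloc P S i t"
proof -
  have "length (speeds P S i t) = card {p. p < P \<and> assigned S p t = Some i}"
    by (simp add: speeds_def length_filter_conv_card cong: conj_cong)
  then show ?thesis by (simp add: alloc_def)
qed

text \<open>Sorting only permutes the speeds of the job's processors, which leaves the sum
  unchanged.\<close>

lemma sum_speeds: "(\<Sum>j=1..alloc P S i t. f (speeds P S i t ! (j - 1))) = job_sum f P S i t"
proof -
  let ?ps = "filter (\<lambda>p. assigned S p t = Some i) [0..<P]"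
  have "(\<Sum>j=1..alloc P S i t. f (speeds P S i t ! (j - 1)))
      = (\<Sum>j<alloc P S i t. f (speeds P S i t ! j))"
    by (intro sum.reindex_bij_witness[of _ Suc "\<lambda>j. j - 1"]) auto
  also have "\<dots> = sum_list (map f (speeds P S i t))"
    by (simp add: sum_list_sum_nth length_speeds atLeast0LessThan)
  also have "\<dots> = sum_mset (image_mset f (mset (speeds P S i t)))"
    by (simp flip: sum_mset_sum_list)
  also have "mset (speeds P S i t) = mset (map (\<lambda>p. speed S p t) ?ps)"
    by (simp add: speeds_def del: mset_map)
  also have "sum_mset (image_mset f \<dots>) = sum_list (map (\<lambda>p. f (speed S p t)) ?ps)"
    by (simp add: image_mset.compositionality comp_def flip: sum_mset_sum_list)
  also have "\<dots> = (\<Sum>p\<in>set ?ps. f (speed S p t))"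
    by (rule sum_list_distinct_conv_sum_set) simp
  also have "\<dots> = job_sum f P S i t"
    unfolding job_sum_def by (subst sum.inter_filter[symmetric]) (auto intro: sum.cong)
  finally show ?thesis .
qed

locale valid_sched =
  fixes P :: nat and J :: "job list" and S :: schedule
  assumes jobs: "job_set J" and valid: "valid_schedule P J S"
begin

abbreviation "b \<equiv> phase_start P J S"
abbreviation "c \<equiv> completion P J S"
abbreviation "num_phases i \<equiv> length (phases (J ! i))"

lemma assigned_measurable [measurable]:
  "p < P \<Longrightarrow> assigned S p \<in> measurable borel (count_space UNIV)"
  using valid by (simp add: valid_schedule_def)

lemma speed_measurable [measurable]: "p < P \<Longrightarrow> speed S p \<in> borel_measurable borel"
  using valid by (simp add: valid_schedule_def)

lemma speed_nonneg: "p < P \<Longrightarrow> 0 \<le> speed S p t"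
  using valid by (simp add: valid_schedule_def)

lemma job_sum_measurable [measurable]:
  assumes [measurable]: "f \<in> borel_measurable borel"
  shows "job_sum f P S i \<in> borel_measurable borel"
  unfolding job_sum_def by measurable

lemma job_sum_nonneg: "(\<And>x. x \<ge> 0 \<Longrightarrow> f x \<ge> 0) \<Longrightarrow> 0 \<le> job_sum f P S i t"
  unfolding job_sum_def by (intro sum_nonneg) (auto simp: speed_nonneg)

text \<open>Each assigned processor counts for exactly one job; \<open>f 0 = 0\<close> settles the
  unassigned ones, whose speed is 0.\<close>

lemma sum_job_sum:
  assumes "f 0 = 0"
  shows "(\<Sum>i<length J. job_sum f P S i t) = (\<Sum>p<P. f (speed S p t))"
proof -
  have "(\<Sum>i<length J. if assigned S p t = Some i then f (speed S p t) else 0) = f (speed S p t)"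
    if "p < P" for p
  proof (cases "assigned S p t")
    case None
    then show ?thesis using valid assms that by (simp add: valid_schedule_def)
  next
    case (Some i)
    then have "i < length J" using valid that by (simp add: valid_schedule_def)
    with Some show ?thesis by simp
  qed
  then show ?thesis unfolding job_sum_def by (subst sum.swap) (auto intro: sum.cong)
qed

lemma speeds_nonneg:
  assumes "j < alloc P S i t"
  shows "0 \<le> speeds P S i t ! j"
proof -
  have "speeds P S i t ! j \<in> set (speeds P S i t)"
    using assms by (intro nth_mem) (simp add: length_speeds)
  then show ?thesis using speed_nonneg by (auto simp: speeds_def)
qed

lemma rate_le_job_sum: "rate P S i h t \<le> job_sum (\<lambda>x. x) P S i t"
  unfolding rate_def sum_speeds[symmetric]
  by (intro sum_mono2) (auto intro!: speeds_nonneg)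

text \<open>At most N positions contribute to the rate, so \<open>sum_le_powr_sum_powr\<close>
  applies to them; the power of the remaining positions is nonnegative.\<close>

lemma rate_le_par:
  assumes "\<alpha> > 1" "N \<ge> 1" "\<And>j. ereal (real j) \<le> h \<longleftrightarrow> j \<le> N"
  shows "rate P S i h t \<le> real N powr (1 - 1 / \<alpha>) * (1 + job_sum (\<lambda>x. x powr \<alpha>) P S i t)"
proof -
  let ?A = "{j. j \<in> {1..alloc P S i t} \<and> ereal (real j) \<le> h}"
  let ?x = "\<lambda>j. speeds P S i t ! (j - 1)"
  have "card ?A \<le> card {1..N}" using assms(3) by (intro card_mono) auto
  then have "rate P S i h t \<le> real N powr (1 - 1 / \<alpha>) * (1 + (\<Sum>j\<in>?A. ?x j powr \<alpha>))"
    unfolding rate_def using assms by (intro sum_le_powr_sum_powr) (auto intro!: speeds_nonneg)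
  also have "(\<Sum>j\<in>?A. ?x j powr \<alpha>) \<le> job_sum (\<lambda>x. x powr \<alpha>) P S i t"
    unfolding sum_speeds[symmetric] by (intro sum_mono2) auto
  finally show ?thesis by (simp add: mult_left_mono)
qed

text \<open>All three facts are read off the infimum of \<open>finish_times\<close>, a set that is
  nonempty by validity and bounded below by the phase start. The infimum is not known to be
  attained, so the last two avoid the end of the phase; the two continuity lemmas above close that
  gap.\<close>

lemma
  assumes "i < length J" "k < num_phases i"
  shows start_le_Suc: "b i k \<le> b i (Suc k)"
    and finish_times_less: "b i (Suc k) < t \<Longrightarrow> ennreal (work (phases (J ! i) ! k)) \<le>
        (\<integral>\<^sup>+x\<in>{b i k..t}. ennreal (rate P S i (par (phases (J ! i) ! k)) x) \<partial>lborel)"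
    and less_finish_times: "b i k \<le> t \<Longrightarrow> t < b i (Suc k) \<Longrightarrow>
        (\<integral>\<^sup>+x\<in>{b i k..t}. ennreal (rate P S i (par (phases (J ! i) ! k)) x) \<partial>lborel)
        < ennreal (work (phases (J ! i) ! k))"
proof -
  let ?F = "finish_times P J S i k (b i k)"
  have ne: "?F \<noteq> {}" using valid assms by (simp add: valid_schedule_def)
  have bdd: "bdd_below ?F" by (rule bdd_belowI[of _ "b i k"]) (simp add: finish_times_def)
  show "b i k \<le> b i (Suc k)" using ne by (auto intro!: cInf_greatest simp: finish_times_def)
  show "ennreal (work (phases (J ! i) ! k)) \<le>
      (\<integral>\<^sup>+x\<in>{b i k..t}. ennreal (rate P S i (par (phases (J ! i) ! k)) x) \<partial>lborel)"
    if t: "b i (Suc k) < t"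
  proof -
    obtain t' where "t' \<in> ?F" "t' < t" using t ne by (auto simp: cInf_less_iff bdd)
    then have "ennreal (work (phases (J ! i) ! k)) \<le>
      (\<integral>\<^sup>+x\<in>{b i k..t'}. ennreal (rate P S i (par (phases (J ! i) ! k)) x) \<partial>lborel)"
      by (simp add: finish_times_def)
    also have "\<dots> \<le> (\<integral>\<^sup>+x\<in>{b i k..t}. ennreal (rate P S i (par (phases (J ! i) ! k)) x) \<partial>lborel)"
      using \<open>t' < t\<close> by (intro nn_integral_mono) (auto simp: indicator_def)
    finally show ?thesis .
  qed
  show "(\<integral>\<^sup>+x\<in>{b i k..t}. ennreal (rate P S i (par (phases (J ! i) ! k)) x) \<partial>lborel)
        < ennreal (work (phases (J ! i) ! k))" if "b i k \<le> t" "t < b i (Suc k)"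
  proof (rule ccontr)
    assume "\<not> ?thesis"
    then have "t \<in> ?F" using that by (simp add: finish_times_def)
    then have "Inf ?F \<le> t" using bdd by (rule cInf_lower)
    with that show False by simp
  qed
qed

lemma release_le_completion: "i < length J \<Longrightarrow> release (J ! i) \<le> c i"
  using sum_indicator_Ico[of "num_phases i" "b i"] start_le_Suc[of i]
  by (simp add: completion_def)

lemma release_nonneg: "i < length J \<Longrightarrow> 0 \<le> release (J ! i)"
  using jobs by (simp add: job_set_def)

lemma par_ge_1:
  assumes "i < length J" "k < num_phases i"
  shows "1 \<le> par (phases (J ! i) ! k)"
  using jobs nth_mem[OF assms(1)] nth_mem[OF assms(2)] unfolding job_set_def by blast

lemma start_ge_release: "i < length J \<Longrightarrow> k \<le> num_phases i \<Longrightarrow> release (J ! i) \<le> b i k"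
  using sum_indicator_Ico[of k "b i"] start_le_Suc[of i] by simp

lemma start_le_completion:
  assumes "i < length J" "k \<le> num_phases i"
  shows "b i k \<le> c i"
proof -
  have "b i k \<le> b i (num_phases i)"
    using assms(2) by (induction rule: inc_induct) (use assms(1) start_le_Suc order_trans in blast)+
  then show ?thesis by (simp add: completion_def)
qed

lemma flow_time_eq: "ennreal (flow_time P J S) = (\<Sum>i<length J. ennreal (c i - release (J ! i)))"
  unfolding flow_time_def using release_le_completion by (subst sum_ennreal) auto

text \<open>A measurable minorant \<open>f\<close> stands in for \<open>rate\<close>, which is
  defined through a sorted list and whose measurability is not established here.\<close>

lemma phase_integral_le_work:
  fixes f :: "real \<Rightarrow> ennreal"
  assumes "i < length J" "k < num_phases i" and [measurable]: "f \<in> borel_measurable borel"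
    and f: "\<And>x. b i k \<le> x \<Longrightarrow> x < b i (Suc k) \<Longrightarrow>
      f x \<le> ennreal (rate P S i (par (phases (J ! i) ! k)) x)"
  shows "(\<integral>\<^sup>+x\<in>{b i k..<b i (Suc k)}. f x \<partial>lborel) \<le> ennreal (work (phases (J ! i) ! k))"
proof (rule set_nn_integral_Ico_le)
  fix t assume t: "b i k \<le> t" "t < b i (Suc k)"
  have "(\<integral>\<^sup>+x\<in>{b i k..t}. f x \<partial>lborel) \<le>
    (\<integral>\<^sup>+x\<in>{b i k..t}. ennreal (rate P S i (par (phases (J ! i) ! k)) x) \<partial>lborel)"
    using f t by (intro nn_integral_mono) (auto simp: indicator_def)
  also have "\<dots> < ennreal (work (phases (J ! i) ! k))"
    using less_finish_times[OF assms(1,2) t] .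
  finally show "(\<integral>\<^sup>+x\<in>{b i k..t}. f x \<partial>lborel) \<le> ennreal (work (phases (J ! i) ! k))"
    by simp
qed simp

end

text \<open>
  With infinite energy the speeds need not be locally integrable; a phase may then end before
  the integral of its rate reaches its work.
\<close>

locale finite_energy = valid_sched +
  fixes \<alpha> :: real
  assumes \<alpha>: "\<alpha> > 1" and energy: "energy \<alpha> P S < \<infinity>"
begin

lemma total_power_measurable [measurable]: "total_power \<alpha> P S \<in> borel_measurable borel"
  unfolding total_power_def by measurable

lemma total_power_nonneg: "0 \<le> total_power \<alpha> P S t"
  unfolding total_power_def by (intro sum_nonneg) simp

text \<open>Dually, \<open>f\<close> is a measurable majorant of the rate. Its bound in terms of
  power, together with finite energy, gives the finite integral slightly beyond the phase that
  continuity from above starts from.\<close>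

lemma work_le_phase_integral:
  assumes "i < length J" "k < num_phases i" and [measurable]: "f \<in> borel_measurable borel"
    and rate: "\<And>x. rate P S i (par (phases (J ! i) ! k)) x \<le> f x"
    and f: "\<And>x. f x \<le> C * (1 + total_power \<alpha> P S x)" and "C \<ge> 0"
  shows "ennreal (work (phases (J ! i) ! k)) \<le>
    (\<integral>\<^sup>+x\<in>{b i k..<b i (Suc k)}. ennreal (f x) \<partial>lborel)"
  unfolding set_nn_integral_Icc_eq_Ico[symmetric]
proof (rule le_set_nn_integral_Icc)
  have "0 \<le> b i k" "b i k \<le> b i (Suc k)"
    using start_ge_release[of i k] release_nonneg[of i] start_le_Suc[of i k] assms by auto
  have "(\<integral>\<^sup>+x\<in>{b i k..b i (Suc k) + 1}. ennreal (f x) \<partial>lborel) \<le>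
    (\<integral>\<^sup>+x. ennreal C * (indicator {b i k..b i (Suc k) + 1} x
      + ennreal (total_power \<alpha> P S x) * indicator {0..} x) \<partial>lborel)"
  proof (intro nn_integral_mono)
    fix x
    have "ennreal (f x) \<le> ennreal C * (1 + ennreal (total_power \<alpha> P S x))"
      using ennreal_leI[OF f[of x]] \<open>C \<ge> 0\<close> total_power_nonneg[of x] by (simp add: ennreal_mult)
    then show "ennreal (f x) * indicator {b i k..b i (Suc k) + 1} x \<le>
        ennreal C * (indicator {b i k..b i (Suc k) + 1} x
          + ennreal (total_power \<alpha> P S x) * indicator {0..} x)"
      using \<open>0 \<le> b i k\<close> by (auto simp: indicator_def)
  qed
  also have "\<dots> = ennreal C * (ennreal (b i (Suc k) + 1 - b i k) + energy \<alpha> P S)"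
    using \<open>b i k \<le> b i (Suc k)\<close> by (simp add: nn_integral_cmult nn_integral_add energy_def)
  also have "\<dots> < \<infinity>"
    using energy by (simp add: ennreal_mult_less_top)
  finally show "(\<integral>\<^sup>+x\<in>{b i k..b i (Suc k) + 1}. ennreal (f x) \<partial>lborel) < \<infinity>" .
next
  fix t assume "b i (Suc k) < t"
  then have "ennreal (work (phases (J ! i) ! k)) \<le>
      (\<integral>\<^sup>+x\<in>{b i k..t}. ennreal (rate P S i (par (phases (J ! i) ! k)) x) \<partial>lborel)"
    using finish_times_less assms by blast
  also have "\<dots> \<le> (\<integral>\<^sup>+x\<in>{b i k..t}. ennreal (f x) \<partial>lborel)"
    by (intro nn_integral_mono mult_right_mono ennreal_leI rate) simp
  finally show "ennreal (work (phases (J ! i) ! k)) \<le> \<dots>" .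
qed simp

lemma job_sum_powr_le:
  assumes "i < length J"
  shows "job_sum (\<lambda>x. x powr \<alpha>) P S i t \<le> total_power \<alpha> P S t"
proof -
  have "job_sum (\<lambda>x. x powr \<alpha>) P S i t \<le> (\<Sum>i<length J. job_sum (\<lambda>x. x powr \<alpha>) P S i t)"
    using assms by (intro member_le_sum) (auto intro: job_sum_nonneg)
  also have "\<dots> = total_power \<alpha> P S t"
    unfolding total_power_def by (rule sum_job_sum) simp
  finally show ?thesis .
qed

text \<open>The threshold stays free here, since \<open>load_speed_le\<close> chooses it according
  to the current load.\<close>

lemma sum_speed_le:
  assumes "\<theta> > 0"
  shows "(\<Sum>p<P. speed S p t) \<le> real P * \<theta> + \<theta> powr (1 - \<alpha>) * total_power \<alpha> P S t"
proof -
  have "(\<Sum>p<P. speed S p t) \<le> (\<Sum>p<P. \<theta> + \<theta> powr (1 - \<alpha>) * speed S p t powr \<alpha>)"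
    using assms \<alpha> by (intro sum_mono young_le) (auto simp: speed_nonneg)
  then show ?thesis by (simp add: sum.distrib sum_distrib_left total_power_def)
qed

text \<open>A crude bound of the shape that \<open>work_le_phase_integral\<close> asks for; its
  constant does not reach the conclusion of \<open>total_work_le\<close>.\<close>

lemma job_sum_id_le:
  assumes "i < length J"
  shows "job_sum (\<lambda>x. x) P S i t \<le> (1 + real P) * (1 + total_power \<alpha> P S t)"
proof -
  have "job_sum (\<lambda>x. x) P S i t \<le> (\<Sum>i<length J. job_sum (\<lambda>x. x) P S i t)"
    using assms by (intro member_le_sum) (auto intro: job_sum_nonneg)
  also have "\<dots> = (\<Sum>p<P. speed S p t)"
    by (rule sum_job_sum) simp
  also have "\<dots> \<le> real P + total_power \<alpha> P S t"
    using sum_speed_le[of 1 t] by simp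
  also have "\<dots> \<le> (1 + real P) * (1 + total_power \<alpha> P S t)"
    using total_power_nonneg[of t] by (simp add: algebra_simps)
  finally show ?thesis .
qed

lemma total_work_le:
  assumes "i < length J"
  shows "(\<Sum>k<num_phases i. ennreal (work (phases (J ! i) ! k))) \<le>
    (\<integral>\<^sup>+x\<in>{release (J ! i)..<c i}. ennreal (job_sum (\<lambda>x. x) P S i x) \<partial>lborel)"
proof -
  have "(\<Sum>k<num_phases i. ennreal (work (phases (J ! i) ! k))) \<le>
    (\<Sum>k<num_phases i. \<integral>\<^sup>+x\<in>{b i k..<b i (Suc k)}. ennreal (job_sum (\<lambda>x. x) P S i x) \<partial>lborel)"
    using assms
    by (intro sum_mono work_le_phase_integral[where C = "1 + real P"] job_sum_id_le
        rate_le_job_sum) auto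
  also have "\<dots> =
    (\<integral>\<^sup>+x\<in>{b i 0..<b i (num_phases i)}. ennreal (job_sum (\<lambda>x. x) P S i x) \<partial>lborel)"
    using assms start_le_Suc by (intro set_nn_integral_Ico_partition[symmetric]) auto
  finally show ?thesis by (simp add: completion_def)
qed

text \<open>The work is charged to the length of the phase (the summand 1) and to the energy spent
  on the job during it.\<close>

lemma work_le_par:
  assumes "i < length J" "k < num_phases i" "N \<ge> 1"
    and "\<And>j. ereal (real j) \<le> par (phases (J ! i) ! k) \<longleftrightarrow> j \<le> N"
  shows "ennreal (work (phases (J ! i) ! k)) \<le> ennreal (real N powr (1 - 1 / \<alpha>)) *
    (\<integral>\<^sup>+x\<in>{b i k..<b i (Suc k)}. ennreal (1 + job_sum (\<lambda>x. x powr \<alpha>) P S i x) \<partial>lborel)"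
proof -
  let ?q = "real N powr (1 - 1 / \<alpha>)"
  have "ennreal (work (phases (J ! i) ! k)) \<le>
    (\<integral>\<^sup>+x\<in>{b i k..<b i (Suc k)}. ennreal (?q * (1 + job_sum (\<lambda>x. x powr \<alpha>) P S i x)) \<partial>lborel)"
    using assms \<alpha>
    by (intro work_le_phase_integral[where C = ?q] rate_le_par mult_left_mono add_left_mono
        job_sum_powr_le) auto
  also have "\<dots> = ennreal ?q *
    (\<integral>\<^sup>+x\<in>{b i k..<b i (Suc k)}. ennreal (1 + job_sum (\<lambda>x. x powr \<alpha>) P S i x) \<partial>lborel)"
    by (subst nn_integral_cmult[symmetric]) (auto simp: ennreal_mult' mult.assoc)
  finally show ?thesis .
qed

end


subsection \<open>The algorithm N-EQUI\<close>

locale n_equi_sched = valid_sched +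
  fixes \<alpha> :: real
  assumes \<alpha>: "\<alpha> > 1" and P: "P \<ge> 1" and n_equi: "n_equi \<alpha> P J S"
begin

abbreviation "n \<equiv> num_active P J S"
abbreviation "share t \<equiv> P div n t"

definition prescribed :: "nat \<Rightarrow> real" where
  "prescribed j = (1 / ((\<alpha> - 1) * harm P * real j)) powr (1 / \<alpha>)"

text \<open>The normalising factor of the prescribed speeds: for j \<ge> 1,
  \<open>prescribed j\<close> is j^(-1/\<alpha>) / K.\<close>

definition K :: real where "K = ((\<alpha> - 1) * harm P) powr (1 / \<alpha>)"

lemma harm_ge_1: "1 \<le> (harm P :: real)"
  using harm_mono[OF P, where 'a = real] by (simp add: harm_def)

lemma K_pos: "0 < K"
  using \<alpha> harm_ge_1 by (simp add: K_def)

lemma prescribed_nonneg: "0 \<le> prescribed j"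
  by (simp add: prescribed_def)

text \<open>The speeds decrease with j, so each of the m terms is at least the last one,
  m^(-1/\<alpha>) / K.\<close>

lemma sum_prescribed_ge: "real m powr (1 - 1 / \<alpha>) / K \<le> (\<Sum>j=1..m. prescribed j)"
proof (cases "m = 0")
  case False
  have "real m powr (1 - 1 / \<alpha>) / K = real m * prescribed m"
    using False \<alpha> harm_ge_1
    by (simp add: prescribed_def K_def powr_divide powr_mult powr_diff)
  also have "\<dots> = (\<Sum>j=1..m. prescribed m)"
    by simp
  also have "\<dots> \<le> (\<Sum>j=1..m. prescribed j)"
    unfolding prescribed_def using \<alpha> harm_ge_1
    by (intro sum_mono powr_mono2 divide_left_mono mult_left_mono mult_pos_pos) (use P in auto)
  finally show ?thesis .
qed (use \<alpha> in simp)

lemma rate_active: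
  assumes "active P J S i t"
  shows "rate P S i h t = (\<Sum>j | j \<in> {1..share t} \<and> ereal (real j) \<le> h. prescribed j)"
proof -
  have "i < length J" using assms by (simp add: active_def)
  with n_equi assms show ?thesis
    unfolding n_equi_def rate_def prescribed_def by (auto intro!: sum.cong)
qed

lemma rate_inactive: "i < length J \<Longrightarrow> \<not> active P J S i t \<Longrightarrow> rate P S i h t = 0"
  using n_equi by (simp add: n_equi_def rate_def)

lemma finite_active: "finite {i. active P J S i t}"
  by (rule finite_subset[of _ "{..<length J}"]) (auto simp: active_def)

text \<open>With more than P active jobs the share is 0. They all stay active until the first of
  them completes, so that one makes no progress after t and could not complete, against validity.
  Completion times are excluded because a job still counts as active at the moment it
  completes.\<close>

lemma n_le_P:
  assumes t: "t \<notin> c ` {..<length J}"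
  shows "n t \<le> P"
proof (rule ccontr)
  assume n: "\<not> n t \<le> P"
  let ?A = "{i. active P J S i t}"
  have "?A \<noteq> {}" using n by (metis card.empty le0 num_active_def)
  then obtain i where i: "i \<in> ?A" and min: "\<And>j. j \<in> ?A \<Longrightarrow> c i \<le> c j"
    using arg_min_if_finite[OF finite_active, of t c] by (metis not_le)
  have "i < length J" "release (J ! i) \<le> t" "t < c i"
    using i t by (auto simp: active_def less_le)
  \<comment> \<open>As long as i is active, so is every job of \<open>?A\<close>, since i has the
    least completion time among them.\<close>
  have rate0: "rate P S i h x = 0" if "t \<le> x" for x h
  proof (cases "active P J S i x")
    case True
    have "?A \<subseteq> {i. active P J S i x}"
      using min that True by (force simp: active_def)
    then have "n t \<le> n x"
      unfolding num_active_def by (intro card_mono finite_active)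
    then have "share x = 0" using n by simp
    then show ?thesis using rate_active[OF True, of h] by simp
  qed (use rate_inactive \<open>i < length J\<close> in blast)
  obtain k where k: "k < num_phases i" "b i k \<le> t" "t < b i (Suc k)"
    using \<open>release (J ! i) \<le> t\<close> \<open>t < c i\<close>
    by (auto simp: completion_def intro: Ico_partition[of "b i" t "num_phases i"])
  \<comment> \<open>Adding 1 moves strictly past the end of the phase, where the work is certainly
    done; the rate vanishes from t on, so it was already done at t, too early.\<close>
  have "ennreal (work (phases (J ! i) ! k)) \<le>
    (\<integral>\<^sup>+x\<in>{b i k..b i (Suc k) + 1}. ennreal (rate P S i (par (phases (J ! i) ! k)) x) \<partial>lborel)"
    using \<open>i < length J\<close> k by (intro finish_times_less) auto
  also have "\<dots> = (\<integral>\<^sup>+x\<in>{b i k..t}. ennreal (rate P S i (par (phases (J ! i) ! k)) x) \<partial>lborel)"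
    using k rate0 by (intro nn_integral_cong) (auto simp: indicator_def)
  also have "\<dots> < ennreal (work (phases (J ! i) ! k))"
    using \<open>i < length J\<close> k by (intro less_finish_times) auto
  finally show False by simp
qed

lemma AE_not_completion: "AE t in lborel. t \<notin> c ` {..<length J}"
  by (intro AE_not_in finite_imp_null_set_lborel) auto

section \<open>Ranks by release time\<close>

text \<open>Ties are counted on both sides, as in \<open>card_sq_le_sum_rank\<close>, and an active
  job counts itself.\<close>

definition rank :: "nat \<Rightarrow> real \<Rightarrow> nat" where
  "rank i t = card {j. active P J S j t \<and> release (J ! j) \<le> release (J ! i)}"

lemma card_active_measurable:
  "(\<lambda>t. card {j. active P J S j t \<and> Q j}) \<in> measurable borel (count_space UNIV)"
proof -
  have "card {j. active P J S j t \<and> Q j} =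
    (\<Sum>j<length J. if Q j \<and> release (J ! j) \<le> t \<and> t \<le> c j then 1 else 0)" for t
    unfolding sum.inter_filter[symmetric, OF finite_lessThan] card_eq_sum
    by (intro sum.cong) (auto simp: active_def)
  moreover have "(\<lambda>t. \<Sum>j<length J. if Q j \<and> release (J ! j) \<le> t \<and> t \<le> c j then 1 else 0 :: nat)
      \<in> measurable borel (count_space UNIV)"
    by measurable
  ultimately show ?thesis by simp
qed

lemma n_measurable [measurable]: "n \<in> measurable borel (count_space UNIV)"
  using card_active_measurable[of "\<lambda>_. True"] by (simp add: num_active_def[abs_def])

lemma rank_measurable [measurable]: "rank i \<in> measurable borel (count_space UNIV)"
  using card_active_measurable by (simp add: rank_def[abs_def])

lemma rank_le_n: "rank i t \<le> n t"
  unfolding rank_def num_active_def by (intro card_mono finite_active) auto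

text \<open>Jobs released no later than job i can only leave while job i is active.\<close>

lemma rank_antimono:
  assumes "release (J ! i) \<le> t" "t \<le> t'"
  shows "rank i t' \<le> rank i t"
  unfolding rank_def using assms
  by (intro card_mono finite_subset[OF _ finite_active]) (auto simp: active_def)

section \<open>Flow time, power and speed in terms of the number of active jobs\<close>

lemma n_eq_sum_indicator: "real (n t) = (\<Sum>i<length J. indicator {release (J ! i)..c i} t)"
proof -
  have "{i. active P J S i t} = {i\<in>{..<length J}. t \<in> {release (J ! i)..c i}}"
    by (auto simp: active_def)
  then show ?thesis
    unfolding num_active_def by (simp add: indicator_def Int_def)
qed

lemma nn_integral_n: "(\<integral>\<^sup>+t. ennreal (real (n t)) \<partial>lborel) = ennreal (flow_time P J S)"
proof -
  have "(\<integral>\<^sup>+t. ennreal (real (n t)) \<partial>lborel)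
      = (\<integral>\<^sup>+t. (\<Sum>i<length J. indicator {release (J ! i)..c i} t) \<partial>lborel)"
    unfolding n_eq_sum_indicator
    by (intro nn_integral_cong) (simp add: ennreal_indicator flip: sum_ennreal)
  also have "\<dots> = (\<Sum>i<length J. \<integral>\<^sup>+t. indicator {release (J ! i)..c i} t \<partial>lborel)"
    by (rule nn_integral_sum) simp
  also have "\<dots> = (\<Sum>i<length J. ennreal (c i - release (J ! i)))"
    using release_le_completion by (intro sum.cong) auto
  finally show ?thesis by (simp add: flow_time_eq)
qed

text \<open>The j-th processor of a job uses power 1 / ((\<alpha> - 1) H j). At most P of them add
  up to at most 1 / (\<alpha> - 1) per active job, which is the purpose of the factor H.\<close>

lemma total_power_le: "total_power \<alpha> P S t \<le> real (n t) / (\<alpha> - 1)"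
proof -
  have "job_sum (\<lambda>x. x powr \<alpha>) P S i t \<le> indicator {release (J ! i)..c i} t / (\<alpha> - 1)"
    if i: "i < length J" for i
  proof (cases "active P J S i t")
    case True
    have "job_sum (\<lambda>x. x powr \<alpha>) P S i t = (\<Sum>j=1..share t. prescribed j powr \<alpha>)"
      unfolding sum_speeds[symmetric] prescribed_def
      using n_equi True i by (auto simp: n_equi_def intro!: sum.cong)
    also have "\<dots> = (\<Sum>j=1..share t. 1 / ((\<alpha> - 1) * harm P) * inverse (real j))"
      using \<alpha> harm_ge_1 by (intro sum.cong) (auto simp: prescribed_def powr_powr divide_simps)
    also have "\<dots> = 1 / ((\<alpha> - 1) * harm P) * harm (share t)"
      by (simp add: harm_def sum_distrib_left)
    also have "\<dots> \<le> 1 / ((\<alpha> - 1) * harm P) * harm P"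
      using \<alpha> harm_ge_1 by (intro mult_left_mono harm_mono) auto
    finally show ?thesis using True \<alpha> harm_ge_1 by (simp add: active_def)
  next
    case False
    then have "alloc P S i t = 0" using n_equi i by (simp add: n_equi_def)
    then show ?thesis using \<alpha> by (simp flip: sum_speeds)
  qed
  then have "(\<Sum>i<length J. job_sum (\<lambda>x. x powr \<alpha>) P S i t) \<le>
      (\<Sum>i<length J. indicator {release (J ! i)..c i} t / (\<alpha> - 1))"
    by (intro sum_mono) auto
  moreover have "(\<Sum>i<length J. job_sum (\<lambda>x. x powr \<alpha>) P S i t) = total_power \<alpha> P S t"
    unfolding total_power_def by (rule sum_job_sum) simp
  ultimately show ?thesis
    by (simp add: n_eq_sum_indicator sum_divide_distrib)
qed

lemma energy_le: "energy \<alpha> P S \<le> ennreal (1 / (\<alpha> - 1)) * ennreal (flow_time P J S)"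
proof -
  have "energy \<alpha> P S \<le> (\<integral>\<^sup>+t. ennreal (1 / (\<alpha> - 1)) * ennreal (real (n t)) \<partial>lborel)"
    unfolding energy_def
    using total_power_le \<alpha>
    by (intro nn_integral_mono) (auto simp: indicator_def ennreal_mult'[symmetric] intro!: ennreal_leI)
  also have "\<dots> = ennreal (1 / (\<alpha> - 1)) * ennreal (flow_time P J S)"
    by (subst nn_integral_cmult) (auto simp: nn_integral_n)
  finally show ?thesis .
qed

text \<open>Since the share is at least 1, rounding down loses at most a factor 2, and 2^(1 -
  1/\<alpha>) \<le> 2.\<close>

lemma sum_prescribed_share_ge:
  assumes "0 < n t" "n t \<le> P"
  shows "(real P / real (n t)) powr (1 - 1 / \<alpha>) / (2 * K) \<le> (\<Sum>j=1..share t. prescribed j)"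
proof -
  have "real P / real (n t) / 2 \<le> real (share t)"
  proof -
    have "1 \<le> share t"
      using assms by (simp add: Suc_le_eq div_greater_zero_iff)
    have "P < n t * (share t + 1)"
      using assms by (metis dividend_less_times_div mult.commute mult_Suc_right Suc_eq_plus1 add.commute)
    also have "\<dots> \<le> n t * (2 * share t)"
      using \<open>1 \<le> share t\<close> by (intro mult_left_mono) auto
    finally have "real P \<le> real (n t * (2 * share t))" by linarith
    then show ?thesis using assms by (simp add: field_simps)
  qed
  then have "(real P / real (n t) / 2) powr (1 - 1 / \<alpha>) \<le> real (share t) powr (1 - 1 / \<alpha>)"
    using \<alpha> by (intro powr_mono2) auto
  moreover have "(2::real) powr (1 - 1 / \<alpha>) \<le> 2 powr 1"
    using \<alpha> by (intro powr_mono) auto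
  then have "(real P / real (n t)) powr (1 - 1 / \<alpha>) / 2 \<le> (real P / real (n t)) powr (1 - 1 / \<alpha>) / 2 powr (1 - 1 / \<alpha>)"
    by (intro divide_left_mono) auto
  then have "(real P / real (n t)) powr (1 - 1 / \<alpha>) / 2 \<le> (real P / real (n t) / 2) powr (1 - 1 / \<alpha>)"
    by (simp add: powr_divide powr_mult)
  ultimately have "(real P / real (n t)) powr (1 - 1 / \<alpha>) / 2 / K \<le> real (share t) powr (1 - 1 / \<alpha>) / K"
    using K_pos by (intro divide_right_mono) auto
  also have "\<dots> \<le> (\<Sum>j=1..share t. prescribed j)"
    by (rule sum_prescribed_ge)
  finally show ?thesis by (simp add: field_simps)
qed

end


subsection \<open>Comparison with a schedule of finite energy\<close>

text \<open>Unqualified \<open>b\<close> and \<open>c\<close> belong to the N-EQUI schedule S,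
  \<open>opt.b\<close> and \<open>opt.c\<close> to the schedule T.\<close>

locale comparison = n_equi_sched P J S \<alpha> + opt: finite_energy P J T \<alpha>
  for P J S \<alpha> T
begin

section \<open>Saturated and unsaturated times\<close>

abbreviation "job_power i \<equiv> job_sum (\<lambda>x. x powr \<alpha>) P T i"

definition unsat_phase :: "nat \<Rightarrow> nat \<Rightarrow> real set" where
  "unsat_phase i k = {b i k..<b i (Suc k)} \<inter> {t. par (phases (J ! i) ! k) < ereal (real (share t))}"

definition unsat :: "nat \<Rightarrow> real set" where
  "unsat i = (\<Union>k<num_phases i. unsat_phase i k)"

definition sat :: "nat \<Rightarrow> real set" where
  "sat i = {release (J ! i)..<c i} - unsat i"

text \<open>The rate of every saturated job at time t, whatever its phase.\<close>

definition speed_sum :: "real \<Rightarrow> real" where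
  "speed_sum t = (\<Sum>j=1..share t. prescribed j)"

lemma speed_sum_nonneg: "0 \<le> speed_sum t"
  unfolding speed_sum_def by (intro sum_nonneg prescribed_nonneg)

lemma speed_sum_measurable [measurable]: "speed_sum \<in> borel_measurable borel"
  unfolding speed_sum_def
  by (rule measurable_compose[OF n_measurable, of "\<lambda>m. \<Sum>j=1..P div m. prescribed j"]) simp

lemma unsat_phase_sets [measurable]: "unsat_phase i k \<in> sets borel"
proof -
  have "Measurable.pred borel (\<lambda>t. par (phases (J ! i) ! k) < ereal (real (share t)))"
    by (rule measurable_compose[OF n_measurable,
          of "\<lambda>m. par (phases (J ! i) ! k) < ereal (real (P div m))"]) simp
  then show ?thesis
    unfolding unsat_phase_def by (intro sets.Int) (auto simp: pred_def)
qed

lemma unsat_sets [measurable]: "unsat i \<in> sets borel"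
  unfolding unsat_def by measurable

lemma sat_sets [measurable]: "sat i \<in> sets borel"
  unfolding sat_def by measurable

lemma active_in_phase:
  assumes "i < length J" "k < num_phases i" "b i k \<le> x" "x < b i (Suc k)"
  shows "active P J S i x"
  using assms start_ge_release[of i k] start_le_completion[of i "Suc k"] by (auto simp: active_def)

section \<open>Time spent unsaturated\<close>

text \<open>Both schedules do the same work in the phase. With q = N^(1 - 1/\<alpha>), N-EQUI runs
  it at rate at least q / K while unsaturated, and T pays for it through \<open>work_le_par\<close>
  with factor q; q cancels and K remains.\<close>

lemma emeasure_unsat_phase_le:
  assumes i: "i < length J" and k: "k < num_phases i"
  shows "emeasure lborel (unsat_phase i k) \<le> ennreal K *
    (\<integral>\<^sup>+x\<in>{opt.b i k..<opt.b i (Suc k)}. ennreal (1 + job_power i x) \<partial>lborel)"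
proof (cases "par (phases (J ! i) ! k) = \<infinity>")
  case True
  then show ?thesis by (simp add: unsat_phase_def)
next
  case False
  let ?h = "par (phases (J ! i) ! k)"
  let ?I = "\<integral>\<^sup>+x\<in>{opt.b i k..<opt.b i (Suc k)}. ennreal (1 + job_power i x) \<partial>lborel"
  obtain N where N: "N \<ge> 1" "\<And>j. ereal (real j) \<le> ?h \<longleftrightarrow> j \<le> N"
    using ereal_floor_bound[OF par_ge_1[OF i k]] False by auto
  define q where "q = real N powr (1 - 1 / \<alpha>)"
  have "q > 0" using N by (simp add: q_def)
  have "ennreal (q / K) * emeasure lborel (unsat_phase i k) =
      (\<integral>\<^sup>+x\<in>{b i k..<b i (Suc k)}. ennreal (q / K) * indicator (unsat_phase i k) x \<partial>lborel)"
    by (subst nn_integral_cmult_indicator[symmetric])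
      (auto intro!: nn_integral_cong simp: unsat_phase_def indicator_def)
  also have "\<dots> \<le> ennreal (work (phases (J ! i) ! k))"
  proof (rule phase_integral_le_work[OF i k])
    fix x assume x: "b i k \<le> x" "x < b i (Suc k)"
    show "ennreal (q / K) * indicator (unsat_phase i k) x \<le> ennreal (rate P S i ?h x)"
    proof (cases "x \<in> unsat_phase i k")
      case True
      \<comment> \<open>The share exceeds N, so all N positions that the phase can use are
        filled.\<close>
      then have "\<not> ereal (real (share x)) \<le> ?h" by (simp add: unsat_phase_def not_le)
      then have "N < share x" unfolding N(2) by simp
      then have "{j. j \<in> {1..share x} \<and> ereal (real j) \<le> ?h} = {1..N}"
        unfolding N(2) by auto
      then have "rate P S i ?h x = (\<Sum>j=1..N. prescribed j)"
        using rate_active[OF active_in_phase[OF i k x], of ?h] by simp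
      then show ?thesis using True sum_prescribed_ge[of N] by (simp add: q_def ennreal_leI)
    qed simp
  qed measurable
  also have "\<dots> \<le> ennreal q * ?I"
    unfolding q_def using opt.work_le_par[OF i k N] by simp
  finally have le: "ennreal (q / K) * emeasure lborel (unsat_phase i k) \<le> ennreal q * ?I" .
  have "emeasure lborel (unsat_phase i k)
      = ennreal (K / q) * (ennreal (q / K) * emeasure lborel (unsat_phase i k))"
    using \<open>q > 0\<close> K_pos by (simp flip: mult.assoc ennreal_mult)
  also have "\<dots> \<le> ennreal (K / q) * (ennreal q * ?I)"
    by (intro mult_left_mono le) simp
  also have "\<dots> = ennreal K * ?I"
    using \<open>q > 0\<close> K_pos by (simp flip: mult.assoc ennreal_mult)
  finally show ?thesis .
qed

lemma emeasure_unsat_le: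
  assumes i: "i < length J"
  shows "emeasure lborel (unsat i) \<le> ennreal K *
    (\<integral>\<^sup>+x\<in>{release (J ! i)..<opt.c i}. ennreal (1 + job_power i x) \<partial>lborel)"
proof -
  have "emeasure lborel (unsat i) \<le> (\<Sum>k<num_phases i. emeasure lborel (unsat_phase i k))"
    unfolding unsat_def by (intro emeasure_subadditive_finite) (auto simp: unsat_phase_sets)
  also have "\<dots> \<le> (\<Sum>k<num_phases i. ennreal K *
    (\<integral>\<^sup>+x\<in>{opt.b i k..<opt.b i (Suc k)}. ennreal (1 + job_power i x) \<partial>lborel))"
    using i by (intro sum_mono emeasure_unsat_phase_le) auto
  also have "\<dots> = ennreal K *
    (\<integral>\<^sup>+x\<in>{opt.b i 0..<opt.b i (num_phases i)}. ennreal (1 + job_power i x) \<partial>lborel)"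
    unfolding sum_distrib_left[symmetric]
    using i opt.start_le_Suc
    by (subst set_nn_integral_Ico_partition[of _ "num_phases i" "opt.b i"]) auto
  finally show ?thesis by (simp add: completion_def)
qed

text \<open>Summed over the jobs, the summands 1 give the flow time of T and the job powers give its
  energy.\<close>

lemma sum_emeasure_unsat_le:
  "(\<Sum>i<length J. emeasure lborel (unsat i)) \<le>
    ennreal K * (ennreal (flow_time P J T) + energy \<alpha> P T)"
proof -
  have "(\<integral>\<^sup>+x\<in>{release (J ! i)..<opt.c i}. ennreal (1 + job_power i x) \<partial>lborel) \<le>
      ennreal (opt.c i - release (J ! i)) + (\<integral>\<^sup>+x\<in>{0..}. ennreal (job_power i x) \<partial>lborel)"
    if i: "i < length J" for i
  proof -
    have "(\<integral>\<^sup>+x\<in>{release (J ! i)..<opt.c i}. ennreal (1 + job_power i x) \<partial>lborel) \<le>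
      (\<integral>\<^sup>+x. indicator {release (J ! i)..<opt.c i} x
        + ennreal (job_power i x) * indicator {0..} x \<partial>lborel)"
      using release_nonneg[OF i] opt.job_sum_nonneg[of "\<lambda>x. x powr \<alpha>" i]
      by (intro nn_integral_mono) (auto simp: indicator_def)
    also have "\<dots> = ennreal (opt.c i - release (J ! i)) + (\<integral>\<^sup>+x\<in>{0..}. ennreal (job_power i x) \<partial>lborel)"
      using opt.release_le_completion[OF i] by (subst nn_integral_add) auto
    finally show ?thesis .
  qed
  then have "(\<Sum>i<length J. emeasure lborel (unsat i)) \<le> (\<Sum>i<length J. ennreal K *
      (ennreal (opt.c i - release (J ! i)) + (\<integral>\<^sup>+x\<in>{0..}. ennreal (job_power i x) \<partial>lborel)))"
    by (intro sum_mono order_trans[OF emeasure_unsat_le] mult_left_mono) auto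
  also have "\<dots> = ennreal K * (ennreal (flow_time P J T)
      + (\<Sum>i<length J. \<integral>\<^sup>+x\<in>{0..}. ennreal (job_power i x) \<partial>lborel))"
    by (simp add: opt.flow_time_eq sum.distrib flip: sum_distrib_left)
  also have "(\<Sum>i<length J. \<integral>\<^sup>+x\<in>{0..}. ennreal (job_power i x) \<partial>lborel) = energy \<alpha> P T"
  proof -
    have "total_power \<alpha> P T x = (\<Sum>i<length J. job_power i x)" for x
      unfolding total_power_def by (rule opt.sum_job_sum[symmetric]) simp
    then have "ennreal (total_power \<alpha> P T x) = (\<Sum>i<length J. ennreal (job_power i x))" for x
      by (simp add: opt.job_sum_nonneg)
    then show ?thesis
      unfolding energy_def by (simp only: sum_distrib_right) (subst nn_integral_sum; simp)
  qed
  finally show ?thesis .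
qed

section \<open>Weighted work on saturated jobs\<close>

lemma sat_integral_le_work:
  assumes i: "i < length J"
  shows "(\<integral>\<^sup>+x\<in>sat i. ennreal (speed_sum x) \<partial>lborel) \<le>
    (\<Sum>k<num_phases i. ennreal (work (phases (J ! i) ! k)))"
proof -
  let ?f = "\<lambda>x. ennreal (speed_sum x) * indicator (sat i) x"
  have "(\<integral>\<^sup>+x. ?f x \<partial>lborel) = (\<integral>\<^sup>+x\<in>{b i 0..<b i (num_phases i)}. ?f x \<partial>lborel)"
    by (intro nn_integral_cong) (auto simp: sat_def indicator_def completion_def)
  also have "\<dots> = (\<Sum>k<num_phases i. \<integral>\<^sup>+x\<in>{b i k..<b i (Suc k)}. ?f x \<partial>lborel)"
    using i start_le_Suc by (intro set_nn_integral_Ico_partition) auto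
  also have "\<dots> \<le> (\<Sum>k<num_phases i. ennreal (work (phases (J ! i) ! k)))"
  proof (intro sum_mono phase_integral_le_work)
    fix k x assume k: "k \<in> {..<num_phases i}" and x: "b i k \<le> x" "x < b i (Suc k)"
    let ?h = "par (phases (J ! i) ! k)"
    show "?f x \<le> ennreal (rate P S i ?h x)"
    proof (cases "x \<in> sat i")
      case True
      then have "ereal (real (share x)) \<le> ?h"
        using k x by (auto simp: sat_def unsat_def unsat_phase_def not_less)
      then have "{j. j \<in> {1..share x} \<and> ereal (real j) \<le> ?h} = {1..share x}"
        by (auto intro: order_trans[rotated])
      then have "rate P S i ?h x = speed_sum x"
        using rate_active[OF active_in_phase[OF i _ x], of ?h] k by (simp add: speed_sum_def)
      then show ?thesis by (simp add: indicator_def)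
    qed simp
  qed (use i in auto)
  finally show ?thesis .
qed

text \<open>The exponent matches \<open>sum_prescribed_share_ge\<close>: in the product of weight
  and \<open>speed_sum\<close> the powers of P cancel, which leaves (rank / n)^(1 - 1/\<alpha>)
  \<ge> rank / n up to the factor 2 K.\<close>

definition weight :: "nat \<Rightarrow> real \<Rightarrow> real" where
  "weight i t = (real (rank i t) / real P) powr (1 - 1 / \<alpha>)"

lemma weight_nonneg: "0 \<le> weight i t"
  by (simp add: weight_def)

lemma weight_measurable [measurable]: "weight i \<in> borel_measurable borel"
  unfolding weight_def
  by (rule measurable_compose[OF rank_measurable, of "\<lambda>m. (real m / real P) powr (1 - 1 / \<alpha>)"]) simp

lemma weight_antimono:
  assumes "release (J ! i) \<le> t" "t \<le> t'"
  shows "weight i t' \<le> weight i t"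
  unfolding weight_def using rank_antimono[OF assms] \<alpha>
  by (intro powr_mono2 divide_right_mono) auto

text \<open>The weight at the largest possible rank, common to all jobs.\<close>

abbreviation "load t \<equiv> (real (n t) / real P) powr (1 - 1 / \<alpha>)"

lemma load_measurable [measurable]: "(\<lambda>t. load t) \<in> borel_measurable borel"
  by (rule measurable_compose[OF n_measurable, of "\<lambda>m. (real m / real P) powr (1 - 1 / \<alpha>)"]) simp

lemma weight_le_load: "weight i t \<le> load t"
  unfolding weight_def using rank_le_n[of i t] \<alpha>
  by (intro powr_mono2 divide_right_mono) auto

definition late :: "nat \<Rightarrow> real set" where
  "late i = sat i \<inter> {opt.c i<..}"

lemma late_sets [measurable]: "late i \<in> sets borel"
  unfolding late_def by measurable

text \<open>
  The weight of a job is nonincreasing, and all the work that is done on the job late was done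
  by the comparison schedule before that, when the weight was larger.
\<close>

lemma late_integral_le:
  assumes i: "i < length J"
  shows "(\<integral>\<^sup>+x\<in>late i. ennreal (weight i x * speed_sum x) \<partial>lborel) \<le>
    (\<integral>\<^sup>+x\<in>{0..}. ennreal (load x * job_sum (\<lambda>x. x) P T i x) \<partial>lborel)"
proof -
  let ?w = "weight i (opt.c i)"
  have r: "0 \<le> release (J ! i)" "release (J ! i) \<le> opt.c i"
    using release_nonneg[OF i] opt.release_le_completion[OF i] by auto
  have "(\<integral>\<^sup>+x\<in>late i. ennreal (weight i x * speed_sum x) \<partial>lborel) \<le>
      (\<integral>\<^sup>+x. ennreal ?w * (ennreal (speed_sum x) * indicator (sat i) x) \<partial>lborel)"
  proof (intro nn_integral_mono)
    fix x
    show "ennreal (weight i x * speed_sum x) * indicator (late i) x \<le>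
        ennreal ?w * (ennreal (speed_sum x) * indicator (sat i) x)"
      using weight_antimono[of i "opt.c i" x] r weight_nonneg speed_sum_nonneg
      by (auto simp: indicator_def late_def ennreal_mult'[symmetric] intro!: ennreal_leI mult_right_mono)
  qed
  also have "\<dots> = ennreal ?w * (\<integral>\<^sup>+x\<in>sat i. ennreal (speed_sum x) \<partial>lborel)"
    by (rule nn_integral_cmult) measurable
  also have "\<dots> \<le> ennreal ?w *
      (\<integral>\<^sup>+x\<in>{release (J ! i)..<opt.c i}. ennreal (job_sum (\<lambda>x. x) P T i x) \<partial>lborel)"
    by (intro mult_left_mono order_trans[OF sat_integral_le_work opt.total_work_le] i) simp
  also have "\<dots> = (\<integral>\<^sup>+x. ennreal ?w *
      (ennreal (job_sum (\<lambda>x. x) P T i x) * indicator {release (J ! i)..<opt.c i} x) \<partial>lborel)"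
    by (rule nn_integral_cmult[symmetric]) measurable
  also have "\<dots> \<le> (\<integral>\<^sup>+x\<in>{0..}. ennreal (load x * job_sum (\<lambda>x. x) P T i x) \<partial>lborel)"
  proof (intro nn_integral_mono)
    fix x
    have "?w \<le> load x" if "release (J ! i) \<le> x" "x < opt.c i"
      using weight_antimono[of i x "opt.c i"] weight_le_load[of i x] that by simp
    then show "ennreal ?w *
        (ennreal (job_sum (\<lambda>x. x) P T i x) * indicator {release (J ! i)..<opt.c i} x) \<le>
        ennreal (load x * job_sum (\<lambda>x. x) P T i x) * indicator {0..} x"
      using r weight_nonneg[of i "opt.c i"] opt.job_sum_nonneg[of "\<lambda>x. x" i x]
      by (auto simp: indicator_def ennreal_mult'[symmetric] intro!: ennreal_leI mult_right_mono)
  qed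
  finally show ?thesis .
qed

text \<open>The factor 4 K is the one in front of the late work in \<open>n_le_pointwise\<close>.
  The coefficient 1/2 of n lets the flow time be absorbed in the end.\<close>

lemma load_speed_le:
  "4 * K * (load t * (\<Sum>p<P. speed T p t)) \<le>
    real (n t) / 2 + 8 powr \<alpha> * (\<alpha> - 1) * harm P / 2 * total_power \<alpha> P T t"
proof (cases "n t = 0")
  case True
  then show ?thesis using \<alpha> harm_ge_1 opt.total_power_nonneg[of t] by simp
next
  case False
  define z where "z = real (n t) / real P"
  \<comment> \<open>The factor z^(1/\<alpha>) makes the first Young term proportional to n and the
    coefficient of the power independent of z. The 8 K turns the first term into n / 2 and that
    coefficient into (8 K)^\<alpha> / 2.\<close>
  define \<theta> where "\<theta> = z powr (1 / \<alpha>) / (8 * K)"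
  have z: "z > 0" using False P by (simp add: z_def)
  have "\<theta> > 0" using z K_pos by (simp add: \<theta>_def)
  have z1: "z powr (1 - 1 / \<alpha>) * z powr (1 / \<alpha>) = z"
    using z by (simp flip: powr_add)
  have "\<theta> powr (1 - \<alpha>) = (z powr (1 / \<alpha>)) powr (1 - \<alpha>) * (8 * K) powr (\<alpha> - 1)"
    using K_pos z powr_minus_divide[of "8 * K" "1 - \<alpha>"] by (simp add: \<theta>_def powr_divide)
  also have "(z powr (1 / \<alpha>)) powr (1 - \<alpha>) = z powr (- (1 - 1 / \<alpha>))"
    using \<alpha> by (simp add: powr_powr diff_divide_distrib)
  finally have "z powr (1 - 1 / \<alpha>) * \<theta> powr (1 - \<alpha>) = (8 * K) powr (\<alpha> - 1)"
    using z powr_add[of z "1 - 1 / \<alpha>" "- (1 - 1 / \<alpha>)"] by simp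
  then have "4 * K * (z powr (1 - 1 / \<alpha>) * \<theta> powr (1 - \<alpha>)) = (8 * K) * (8 * K) powr (\<alpha> - 1) / 2"
    by simp
  also have "(8 * K) * (8 * K) powr (\<alpha> - 1) = (8 * K) powr \<alpha>"
    using K_pos by (simp add: powr_mult_base)
  also have "\<dots> = 8 powr \<alpha> * ((\<alpha> - 1) * harm P)"
    using K_pos \<alpha> harm_ge_1 by (simp add: powr_mult K_def powr_powr)
  finally have 2: "4 * K * (z powr (1 - 1 / \<alpha>) * \<theta> powr (1 - \<alpha>)) = 8 powr \<alpha> * ((\<alpha> - 1) * harm P) / 2" .
  have "4 * K * (z powr (1 - 1 / \<alpha>) * (real P * \<theta>)) = real P * (z powr (1 - 1 / \<alpha>) * z powr (1 / \<alpha>)) / 2"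
    using K_pos by (simp add: \<theta>_def)
  also have "\<dots> = real (n t) / 2"
    unfolding z1 using P by (simp add: z_def)
  finally have 1: "4 * K * (z powr (1 - 1 / \<alpha>) * (real P * \<theta>)) = real (n t) / 2" .
  have "4 * K * (z powr (1 - 1 / \<alpha>) * (\<Sum>p<P. speed T p t)) \<le>
    4 * K * (z powr (1 - 1 / \<alpha>) * (real P * \<theta> + \<theta> powr (1 - \<alpha>) * total_power \<alpha> P T t))"
    using K_pos opt.sum_speed_le[OF \<open>\<theta> > 0\<close>] by (intro mult_left_mono) auto
  also have "\<dots> = 4 * K * (z powr (1 - 1 / \<alpha>) * (real P * \<theta>)) +
      4 * K * (z powr (1 - 1 / \<alpha>) * \<theta> powr (1 - \<alpha>)) * total_power \<alpha> P T t"
    by (simp add: algebra_simps)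
  finally show ?thesis unfolding 1 2 by (simp add: z_def mult.assoc)
qed

text \<open>The load is the same for all jobs, so their speeds in T add up to the total speed, and
  \<open>load_speed_le\<close> can be integrated.\<close>

lemma sum_late_integral_le:
  "ennreal (4 * K) * (\<Sum>i<length J. \<integral>\<^sup>+x\<in>late i. ennreal (weight i x * speed_sum x) \<partial>lborel) \<le>
    ennreal (flow_time P J S / 2) + ennreal (8 powr \<alpha> * (\<alpha> - 1) * harm P / 2) * energy \<alpha> P T"
proof -
  let ?c = "8 powr \<alpha> * (\<alpha> - 1) * harm P / 2"
  have "(\<Sum>i<length J. \<integral>\<^sup>+x\<in>late i. ennreal (weight i x * speed_sum x) \<partial>lborel) \<le>
    (\<Sum>i<length J. \<integral>\<^sup>+x\<in>{0..}. ennreal (load x * job_sum (\<lambda>x. x) P T i x) \<partial>lborel)"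
    by (intro sum_mono late_integral_le) auto
  also have "\<dots> = (\<integral>\<^sup>+x. (\<Sum>i<length J. ennreal (load x * job_sum (\<lambda>x. x) P T i x) * indicator {0..} x) \<partial>lborel)"
    by (rule nn_integral_sum[symmetric]) measurable
  also have "\<dots> = (\<integral>\<^sup>+x\<in>{0..}. ennreal (load x * (\<Sum>p<P. speed T p x)) \<partial>lborel)"
    by (intro nn_integral_cong)
      (simp add: opt.job_sum_nonneg sum_distrib_left flip: sum_distrib_right opt.sum_job_sum[of "\<lambda>x. x"])
  finally have "ennreal (4 * K) * (\<Sum>i<length J. \<integral>\<^sup>+x\<in>late i. ennreal (weight i x * speed_sum x) \<partial>lborel) \<le>
      ennreal (4 * K) * (\<integral>\<^sup>+x\<in>{0..}. ennreal (load x * (\<Sum>p<P. speed T p x)) \<partial>lborel)"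
    by (intro mult_left_mono) auto
  also have "\<dots> = (\<integral>\<^sup>+x. ennreal (4 * K) * (ennreal (load x * (\<Sum>p<P. speed T p x)) * indicator {0..} x) \<partial>lborel)"
    by (rule nn_integral_cmult[symmetric]) measurable
  also have "\<dots> \<le> (\<integral>\<^sup>+x. ennreal (1 / 2) * ennreal (real (n x)) +
      ennreal ?c * (ennreal (total_power \<alpha> P T x) * indicator {0..} x) \<partial>lborel)"
  proof (intro nn_integral_mono)
    fix x
    have "ennreal (4 * K * (load x * (\<Sum>p<P. speed T p x))) \<le> ennreal (1 / 2 * real (n x) + ?c * total_power \<alpha> P T x)"
      using load_speed_le[of x] by (intro ennreal_leI) simp
    also have "\<dots> = ennreal (1 / 2) * ennreal (real (n x)) + ennreal ?c * ennreal (total_power \<alpha> P T x)"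
      using opt.total_power_nonneg[of x] \<alpha> harm_ge_1
      by (subst ennreal_plus; (subst (1 2) ennreal_mult')?) (auto intro!: mult_nonneg_nonneg)
    finally show "ennreal (4 * K) * (ennreal (load x * (\<Sum>p<P. speed T p x)) * indicator {0..} x) \<le>
      ennreal (1 / 2) * ennreal (real (n x)) + ennreal ?c * (ennreal (total_power \<alpha> P T x) * indicator {0..} x)"
      using K_pos by (simp add: indicator_def ennreal_mult' del: ennreal_plus)
  qed
  also have "\<dots> = ennreal (1 / 2) * (\<integral>\<^sup>+x. ennreal (real (n x)) \<partial>lborel) + ennreal ?c * energy \<alpha> P T"
    by (simp add: nn_integral_add nn_integral_cmult energy_def del: ennreal_half)
  also have "ennreal (1 / 2) * (\<integral>\<^sup>+x. ennreal (real (n x)) \<partial>lborel) = ennreal (flow_time P J S / 2)"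
    unfolding nn_integral_n by (subst ennreal_mult'[symmetric]) auto
  finally show ?thesis .
qed

section \<open>Pointwise bound on the number of active jobs\<close>

text \<open>An active job is unfinished in T, unsaturated or late. With x bounding the first two
  kinds and m late jobs, n \<le> x + m is squared so that m^2 can be bounded by the ranks; these
  turn into weighted work at the cost of a factor n, which is then divided out.\<close>

lemma n_le_pointwise:
  assumes t: "t \<notin> c ` {..<length J}"
  shows "real (n t) \<le> 2 * (\<Sum>i<length J. indicator {release (J ! i)..opt.c i} t)
    + 2 * (\<Sum>i<length J. indicator (unsat i) t)
    + 4 * K * (\<Sum>i<length J. weight i t * speed_sum t * indicator (late i) t)"
    (is "_ \<le> 2 * ?X + 2 * ?Y + 4 * K * ?Z")
proof (cases "n t = 0")
  case True
  then show ?thesis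
    using K_pos weight_nonneg speed_sum_nonneg
    by (auto intro!: add_nonneg_nonneg mult_nonneg_nonneg sum_nonneg)
next
  case False
  let ?A = "{i. active P J S i t}"
  let ?B = "{i\<in>?A. t \<in> late i}"
  have fin: "finite ?A" by (rule finite_active)
  have card: "real (card {i. i < length J \<and> t \<in> f i}) = (\<Sum>i<length J. indicator (f i) t)"
    for f :: "nat \<Rightarrow> real set"
    by (simp add: indicator_def Int_def)
  define x where "x = ?X + ?Y"
  define m where "m = real (card ?B)"
  have "?A \<subseteq> {i. i < length J \<and> t \<in> {release (J ! i)..opt.c i}} \<union> {i. i < length J \<and> t \<in> unsat i} \<union> ?B"
  proof
    fix i assume "i \<in> ?A"
    \<comment> \<open>\<open>sat\<close> omits the completion time itself.\<close>
    moreover from this have "t \<noteq> c i" using t by (auto simp: active_def)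
    ultimately show "i \<in> {i. i < length J \<and> t \<in> {release (J ! i)..opt.c i}} \<union> {i. i < length J \<and> t \<in> unsat i} \<union> ?B"
      by (auto simp: active_def late_def sat_def)
  qed
  then have "n t \<le> card ({i. i < length J \<and> t \<in> {release (J ! i)..opt.c i}} \<union> {i. i < length J \<and> t \<in> unsat i} \<union> ?B)"
    unfolding num_active_def using fin by (intro card_mono) auto
  also have "\<dots> \<le> card {i. i < length J \<and> t \<in> {release (J ! i)..opt.c i}} + card {i. i < length J \<and> t \<in> unsat i} + card ?B"
    by (intro order_trans[OF card_Un_le] add_right_mono card_Un_le)
  finally have le: "real (n t) \<le> x + m"
    unfolding x_def m_def card[symmetric] by linarith
  have "x \<ge> 0" unfolding x_def by (intro add_nonneg_nonneg sum_nonneg) auto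
  have n: "0 < real (n t)" using False by simp
  have "(real (n t))\<^sup>2 \<le> 2 * x * real (n t) + m\<^sup>2"
  \<comment> \<open>Squaring n - x \<le> m requires n - x to be nonnegative.\<close>
  proof (cases "real (n t) \<le> x")
    case True
    then have "real (n t) * real (n t) \<le> x * real (n t)" by (intro mult_right_mono) auto
    moreover have "0 \<le> x * real (n t)" "0 \<le> m\<^sup>2" using \<open>x \<ge> 0\<close> by auto
    ultimately show ?thesis unfolding power2_eq_square by linarith
  next
    case False
    then have "(real (n t) - x)\<^sup>2 \<le> m\<^sup>2" using le by (intro power_mono) auto
    moreover have "(real (n t) - x)\<^sup>2 = (real (n t))\<^sup>2 - 2 * x * real (n t) + x\<^sup>2"
      by (simp add: power2_diff)
    moreover have "x\<^sup>2 \<ge> 0" by simp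
    ultimately show ?thesis by linarith
  qed
  also have "m\<^sup>2 \<le> 2 * (\<Sum>i\<in>?B. real (card {j\<in>?B. release (J ! j) \<le> release (J ! i)}))"
    unfolding m_def using fin by (intro card_sq_le_sum_rank) simp
  \<comment> \<open>Ranks within the late jobs are at most the ranks among all active jobs.\<close>
  also have "\<dots> \<le> 2 * (\<Sum>i\<in>?B. real (rank i t))"
    unfolding rank_def
    by (intro mult_left_mono sum_mono of_nat_mono card_mono finite_subset[OF _ fin]) auto
  also have "\<dots> \<le> 2 * (\<Sum>i\<in>?B. real (n t) * (2 * K * (weight i t * speed_sum t)))"
  proof (intro mult_left_mono sum_mono)
    fix i
    \<comment> \<open>The quotient is at most 1, so lowering the exponent from 1 to 1 - 1/\<alpha>
      does not decrease it.\<close>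
    have "real (rank i t) / real (n t) \<le> (real (rank i t) / real (n t)) powr (1 - 1 / \<alpha>)"
    proof (cases "rank i t = 0")
      case False
      have "(real (rank i t) / real (n t)) powr 1 \<le> (real (rank i t) / real (n t)) powr (1 - 1 / \<alpha>)"
        using n False rank_le_n[of i t] \<alpha> by (intro powr_mono') auto
      then show ?thesis by simp
    qed simp
    also have "\<dots> = weight i t * (real P / real (n t)) powr (1 - 1 / \<alpha>)"
      unfolding weight_def using P by (subst powr_mult[symmetric]) auto
    also have "\<dots> \<le> weight i t * (2 * K * speed_sum t)"
      using sum_prescribed_share_ge[of t] n_le_P[OF t] n K_pos weight_nonneg
      by (intro mult_left_mono) (auto simp: speed_sum_def field_simps)
    finally show "real (rank i t) \<le> real (n t) * (2 * K * (weight i t * speed_sum t))"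
      using n by (simp add: field_simps)
  qed simp
  also have "\<dots> = real (n t) * (4 * K * (\<Sum>i\<in>?B. weight i t * speed_sum t))"
    by (simp add: sum_distrib_left mult_ac)
  also have "(\<Sum>i\<in>?B. weight i t * speed_sum t) \<le> ?Z"
  proof -
    have "(\<Sum>i\<in>?B. weight i t * speed_sum t) = (\<Sum>i\<in>?B. weight i t * speed_sum t * indicator (late i) t)"
      by (intro sum.cong) auto
    also have "\<dots> \<le> ?Z"
      using weight_nonneg speed_sum_nonneg
      by (intro sum_mono2) (auto simp: active_def)
    finally show ?thesis .
  qed
  finally have "(real (n t))\<^sup>2 \<le> 2 * x * real (n t) + real (n t) * (4 * K * ?Z)"
    using K_pos n by (simp add: mult_left_mono)
  then have "real (n t) * real (n t) \<le> real (n t) * (2 * x + 4 * K * ?Z)"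
    by (simp add: power2_eq_square algebra_simps)
  then have "real (n t) \<le> 2 * x + 4 * K * ?Z"
    using n by (simp add: mult_le_cancel_left_pos)
  then show ?thesis by (simp add: x_def)
qed

text \<open>This integrates \<open>n_le_pointwise\<close>. Half of the flow time of S remains on the
  right; it is subtracted only after the passage to real numbers in
  \<open>flow_time_le\<close>.\<close>

lemma flow_time_le_half:
  "ennreal (flow_time P J S) \<le> 2 * ennreal (flow_time P J T)
    + 2 * (ennreal K * (ennreal (flow_time P J T) + energy \<alpha> P T))
    + (ennreal (flow_time P J S / 2) + ennreal (8 powr \<alpha> * (\<alpha> - 1) * harm P / 2) * energy \<alpha> P T)"
proof -
  let ?X = "\<lambda>t. \<Sum>i<length J. indicator {release (J ! i)..opt.c i} t"
  let ?Y = "\<lambda>t. \<Sum>i<length J. indicator (unsat i) t"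
  let ?Z = "\<lambda>t. \<Sum>i<length J. ennreal (weight i t * speed_sum t) * indicator (late i) t"
  have "ennreal (flow_time P J S) = (\<integral>\<^sup>+t. ennreal (real (n t)) \<partial>lborel)"
    by (rule nn_integral_n[symmetric])
  also have "\<dots> \<le> (\<integral>\<^sup>+t. 2 * ?X t + 2 * ?Y t + ennreal (4 * K) * ?Z t \<partial>lborel)"
  proof (intro nn_integral_mono_AE eventually_mono[OF AE_not_completion])
    fix t assume t: "t \<notin> c ` {..<length J}"
    have ind: "ennreal (\<Sum>i<length J. indicator (f i) t) = (\<Sum>i<length J. indicator (f i) t)"
      for f :: "nat \<Rightarrow> real set"
      by (subst sum_ennreal[symmetric]) (auto simp: ennreal_indicator)
    have Z: "ennreal (\<Sum>i<length J. weight i t * speed_sum t * indicator (late i) t) = ?Z t"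
      using weight_nonneg speed_sum_nonneg
      by (subst sum_ennreal[symmetric]) (auto simp: ennreal_mult' ennreal_indicator)
    have "ennreal (real (n t)) \<le> ennreal (2 * ?X t + 2 * ?Y t
      + 4 * K * (\<Sum>i<length J. weight i t * speed_sum t * indicator (late i) t))"
      by (intro ennreal_leI n_le_pointwise t)
    also have "\<dots> = ennreal (2 * ?X t) + ennreal (2 * ?Y t)
      + ennreal (4 * K * (\<Sum>i<length J. weight i t * speed_sum t * indicator (late i) t))"
      using weight_nonneg speed_sum_nonneg K_pos
      by (subst ennreal_plus; (subst ennreal_plus)?)
        (auto intro!: add_nonneg_nonneg mult_nonneg_nonneg sum_nonneg)
    also have "\<dots> = 2 * ?X t + 2 * ?Y t + ennreal (4 * K) * ?Z t"
      using K_pos unfolding Z[symmetric] ind[symmetric]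
      by (simp only: ennreal_mult'[of 2] ennreal_mult'[of "4 * K"]) (simp add: ennreal_mult')
    finally show "ennreal (real (n t)) \<le> 2 * ?X t + 2 * ?Y t + ennreal (4 * K) * ?Z t" .
  qed
  also have "\<dots> = 2 * (\<Sum>i<length J. \<integral>\<^sup>+t. indicator {release (J ! i)..opt.c i} t \<partial>lborel)
    + 2 * (\<Sum>i<length J. \<integral>\<^sup>+t. indicator (unsat i) t \<partial>lborel)
    + ennreal (4 * K) * (\<Sum>i<length J. \<integral>\<^sup>+t\<in>late i. ennreal (weight i t * speed_sum t) \<partial>lborel)"
    by (simp add: nn_integral_add nn_integral_cmult nn_integral_sum
        del: sum_mult_indicator nn_integral_indicator)
  also have "(\<Sum>i<length J. \<integral>\<^sup>+t. indicator {release (J ! i)..opt.c i} t \<partial>lborel)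
      = ennreal (flow_time P J T)"
    using opt.release_le_completion by (simp add: opt.flow_time_eq)
  also have "(\<Sum>i<length J. \<integral>\<^sup>+t. indicator (unsat i) t \<partial>lborel)
      = (\<Sum>i<length J. emeasure lborel (unsat i))"
    by simp
  finally show ?thesis
    by (rule order_trans)
      (intro add_mono mult_left_mono order_refl sum_emeasure_unsat_le sum_late_integral_le, simp)
qed

section \<open>Collecting the constants\<close>

lemma flow_time_nonneg: "0 \<le> flow_time P J S"
  unfolding flow_time_def using release_le_completion by (intro sum_nonneg) auto

text \<open>Here y^(1/\<alpha>) \<le> 1 + y for y = (\<alpha> - 1) H, and H \<ge> 1 absorbs the
  1.\<close>

lemma K_le: "K \<le> \<alpha> * harm P"
proof -
  let ?y = "(\<alpha> - 1) * harm P"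
  have "K \<le> 1 + ?y"
  proof (cases "?y \<le> 1")
    case True
    then have "K \<le> 1" unfolding K_def using \<alpha> harm_ge_1 by (intro powr_le1) auto
    then show ?thesis using \<alpha> harm_ge_1 by (simp add: add_increasing2)
  next
    case False
    then have "K \<le> ?y powr 1" unfolding K_def using \<alpha> by (intro powr_mono) auto
    then show ?thesis using False by simp
  qed
  also have "\<dots> \<le> \<alpha> * harm P" using harm_ge_1 by (simp add: algebra_simps)
  finally show ?thesis .
qed

lemma flow_time_le:
  "ennreal (flow_time P J S) \<le>
    ennreal ((4 + 4 * \<alpha> + 8 powr \<alpha> * (\<alpha> - 1)) * harm P) * total_cost \<alpha> P J T"
proof -
  define e where "e = enn2real (energy \<alpha> P T)"
  define f where "f = flow_time P J T"
  define H where "H = (harm P :: real)"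
  define d where "d = 8 powr \<alpha> * (\<alpha> - 1)"
  have e: "energy \<alpha> P T = ennreal e" "e \<ge> 0"
    using opt.energy by (auto simp: e_def)
  have f: "f \<ge> 0"
    unfolding f_def flow_time_def using opt.release_le_completion by (intro sum_nonneg) auto
  have H: "H \<ge> 1" using harm_ge_1 by (simp add: H_def)
  have d: "d \<ge> 0" using \<alpha> by (simp add: d_def)
  have "ennreal (flow_time P J S) \<le>
      ennreal (2 * f + 2 * (K * (f + e)) + (flow_time P J S / 2 + d * H / 2 * e))"
    using flow_time_le_half K_pos flow_time_nonneg e f H d ennreal_mult'[of "d * H / 2" e]
    by (simp add: ennreal_mult' f_def[symmetric] H_def[symmetric] d_def[symmetric])
  then have "flow_time P J S \<le> 2 * f + 2 * (K * (f + e)) + (flow_time P J S / 2 + d * H / 2 * e)"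
    using K_pos flow_time_nonneg e f H d by (subst (asm) ennreal_le_iff) auto
  \<comment> \<open>Absorbing half of the left side doubles every other coefficient; each is then
    bounded by a multiple of H.\<close>
  then have "flow_time P J S \<le> 4 * f + 4 * (K * (f + e)) + d * H * e"
    by (simp add: field_simps)
  also have "\<dots> \<le> 4 * (H * (f + e)) + 4 * (\<alpha> * H * (f + e)) + d * H * (f + e)"
  proof (intro add_mono mult_left_mono mult_right_mono)
    show "f \<le> H * (f + e)" using mult_mono[of 1 H f "f + e"] H f e by simp
    show "K \<le> \<alpha> * H" using K_le by (simp add: H_def)
  qed (use H f e d in auto)
  also have "\<dots> = (4 + 4 * \<alpha> + d) * H * (f + e)"
    by (simp add: algebra_simps)
  finally have "ennreal (flow_time P J S) \<le> ennreal ((4 + 4 * \<alpha> + d) * H * (f + e))"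
    by (rule ennreal_leI)
  also have "\<dots> = ennreal ((4 + 4 * \<alpha> + d) * H) * total_cost \<alpha> P J T"
    unfolding total_cost_def e(1) using \<alpha> H d f e(2)
    by (simp add: f_def ennreal_mult' flip: ennreal_plus)
  finally show ?thesis by (simp add: H_def d_def)
qed

text \<open>Energy adds at most the fraction 1 / (\<alpha> - 1) of the flow time, hence the factor
  \<alpha> / (\<alpha> - 1).\<close>

lemma total_cost_le:
  "total_cost \<alpha> P J S \<le> ennreal (\<alpha> / (\<alpha> - 1) *
    ((4 + 4 * \<alpha> + 8 powr \<alpha> * (\<alpha> - 1)) * harm P)) * total_cost \<alpha> P J T"
proof -
  have "total_cost \<alpha> P J S \<le>
      ennreal (flow_time P J S) + ennreal (1 / (\<alpha> - 1)) * ennreal (flow_time P J S)"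
    unfolding total_cost_def by (intro add_left_mono energy_le)
  also have "\<dots> = ennreal (flow_time P J S + 1 / (\<alpha> - 1) * flow_time P J S)"
    using \<alpha> flow_time_nonneg by (subst ennreal_plus) (auto simp: ennreal_mult' simp flip: ennreal_mult)
  also have "flow_time P J S + 1 / (\<alpha> - 1) * flow_time P J S = \<alpha> / (\<alpha> - 1) * flow_time P J S"
    using \<alpha> by (simp add: field_simps)
  also have "ennreal \<dots> = ennreal (\<alpha> / (\<alpha> - 1)) * ennreal (flow_time P J S)"
    using \<alpha> by (intro ennreal_mult') auto
  also have "\<dots> \<le> ennreal (\<alpha> / (\<alpha> - 1)) * (ennreal ((4 + 4 * \<alpha> + 8 powr \<alpha> * (\<alpha> - 1)) * harm P)
      * total_cost \<alpha> P J T)"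
    by (intro mult_left_mono flow_time_le) simp
  also have "\<dots> = ennreal (\<alpha> / (\<alpha> - 1) * ((4 + 4 * \<alpha> + 8 powr \<alpha> * (\<alpha> - 1)) * harm P))
      * total_cost \<alpha> P J T"
    using \<alpha> by (subst ennreal_mult') (auto simp: mult.assoc)
  finally show ?thesis .
qed

end

section \<open>From the harmonic number to the logarithm, and the competitive ratio\<close>

lemma harm_le_ln:
  assumes "P \<ge> 2"
  shows "harm P \<le> 3 * ln (real P)"
proof -
  have "(1::real) / 2 \<le> ln 2" using ln2_ge_two_thirds by simp
  also have "\<dots> \<le> ln (real P)" using assms by simp
  finally have "1 \<le> 2 * ln (real P)" by simp
  moreover have "harm P \<le> 1 + ln (real P)"
    \<comment> \<open>The decreasing sequence is harm (k + 1) - ln (k + 1); index P - 1 is compared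
      with index 0, where the value is 1.\<close>
    using decseqD[OF decseq_harm_diff_ln, of 0 "P - 1"] assms by (simp add: harm_def)
  ultimately show ?thesis by linarith
qed

theorem theorem3:
  fixes \<alpha> :: real
  assumes "\<alpha> > 1"
  shows "\<exists>C::real. C > 0 \<and> (\<forall>P::nat. P \<ge> 2 \<longrightarrow> (\<forall>J. job_set J \<longrightarrow>
           (\<forall>S. valid_schedule P J S \<and> n_equi \<alpha> P J S \<longrightarrow>
              total_cost \<alpha> P J S \<le> ennreal (C * ln (real P)) * opt_cost \<alpha> P J)))"
proof -
  define D where "D = \<alpha> / (\<alpha> - 1) * (4 + 4 * \<alpha> + 8 powr \<alpha> * (\<alpha> - 1))"
  have D: "D > 0"
    unfolding D_def using assms
    by (intro mult_pos_pos divide_pos_pos add_pos_nonneg) auto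
  have "total_cost \<alpha> P J S \<le> ennreal (3 * D * ln (real P)) * opt_cost \<alpha> P J"
    if P: "P \<ge> 2" and J: "job_set J" and S: "valid_schedule P J S" "n_equi \<alpha> P J S" for P J S
  proof -
    define B where "B = 3 * D * ln (real P)"
    have "B > 0" using D P by (simp add: B_def)
    have le: "total_cost \<alpha> P J S \<le> ennreal B * total_cost \<alpha> P J T" if T: "valid_schedule P J T" for T
    \<comment> \<open>Infinite energy makes the right-hand side infinite, so only finite energy
      calls for the comparison.\<close>
    proof (cases "energy \<alpha> P T < \<infinity>")
      case True
      interpret comparison P J S \<alpha> T
        using P J S T True assms by unfold_locales auto
      have "D * harm P \<le> B"
        using harm_le_ln[OF \<open>P \<ge> 2\<close>] D by (simp add: B_def)
      then have "ennreal (D * harm P) * total_cost \<alpha> P J T \<le> ennreal B * total_cost \<alpha> P J T"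
        by (intro mult_right_mono ennreal_leI) auto
      with total_cost_le show ?thesis by (simp add: D_def mult.assoc)
    next
      case False
      then have "energy \<alpha> P T = top" by (simp flip: less_top)
      then show ?thesis using \<open>B > 0\<close> by (simp add: total_cost_def ennreal_mult_top)
    qed
    \<comment> \<open>Dividing by the positive finite B turns the bounds for the individual T into a
      lower bound on the infimum.\<close>
    have "total_cost \<alpha> P J S / ennreal B \<le> opt_cost \<alpha> P J"
      unfolding opt_cost_def
    proof (rule INF_greatest)
      fix T assume "T \<in> {S. valid_schedule P J S}"
      then show "total_cost \<alpha> P J S / ennreal B \<le> total_cost \<alpha> P J T"
        using le[of T] \<open>B > 0\<close> by (simp add: divide_le_posI_ennreal)
    qed
    then have "ennreal B * (total_cost \<alpha> P J S / ennreal B) \<le> ennreal B * opt_cost \<alpha> P J"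
      by (rule mult_left_mono) simp
    also have "ennreal B * (total_cost \<alpha> P J S / ennreal B) = total_cost \<alpha> P J S"
      using \<open>B > 0\<close> mult_divide_eq_ennreal[of "ennreal B" "total_cost \<alpha> P J S"]
      by (simp add: ennreal_times_divide mult.commute)
    finally show ?thesis by (simp add: B_def)
  qed
  with D show ?thesis by (intro exI[of _ "3 * D"]) auto
qed

end
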